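(* Let $Q=\mathrm{SO}(3)\times\mathbb{R}$, let $\mathrm{SO}(3)$ act on $T^*Q$ by the cotangent lift of left translation on the first factor of $Q$, let $\omega_Q$ be the canonical symplectic form on $T^*Q$, let $$H(A,\Pi,\alpha,l)=\frac12\Big[\frac{\Pi_1^2}{\bar I_1}+\frac{\Pi_2^2}{\bar I_2}+\frac{(\Pi_3-l)^2}{\bar I_3}+\frac{l^2}{J_3}\Big],$$ and let $u:T^*Q\to W$ be the control torque acting on the rotor. Then the rigid spacecraft-rotor system with coincident centers of buoyancy and gravity, that is, the 5-tuple $(T^*Q,\mathrm{SO}(3),\omega_Q,H,u)$, is a regular point reducible RCH system. Moreover, for a point $\mu\in\mathfrak{so}^*(3)$ that is a regular value of the momentum map $\mathbf{J}_Q:T^*Q\cong\mathrm{SO}(3)\times\mathfrak{so}^*(3)\times\mathbb{R}\times\mathbb{R}^*\to\mathfrak{so}^*(3)$, the $R_p$-reduced controlled rigid spacecraft-rotor system is the 4-tuple $(\mathcal{O}_\mu\times\mathbb{R}\times\mathbb{R}^*,\ \tilde\omega^-_{\mathcal{O}_\mu\times\mathbb{R}\times\mathbb{R}^*},\ h_\mu,\ u_\mu)$, where $\mathcal{O}_\mu\subset\mathfrak{so}^*(3)$ is the coadjoint orbit of $\mu$, $\tilde\omega^-_{\mathcal{O}_\mu\times\mathbb{R}\times\mathbb{R}^*}$ is the induced symplectic form on $\mathcal{O}_\mu\times\mathbb{R}\times\mathbb{R}^*$, $h_\mu\circ\pi_\mu=H\circ i_\mu$ and $u_\mu\circ\pi_\mu=\pi_\mu\circ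 u\circ i_\mu$. The dynamical vector field $X_{\mathrm{red}}$ of this $R_p$-reduced system satisfies $$X_{\mathrm{red}}=X_{h_\mu}+\mathrm{vlift}(u_\mu)\qquad\text{and}\qquad X_{\mathrm{red}}\circ\pi_\mu=T\pi_\mu\circ\tilde X\circ i_\mu,$$ where $\tilde X=X_H+\mathrm{vlift}(u)$ is the dynamical vector field of $(T^*Q,\mathrm{SO}(3),\omega_Q,H,u)$.
   Context: Manifolds are real, smooth, finite dimensional; actions are smooth left actions. The configuration space $\mathrm{SO}(3)\times S^1$ (attitude of the carrier body, rotor angle) is treated locally, with $S^1$ replaced by $\mathbb{R}$. By left trivialization, $T^*Q\cong\mathrm{SO}(3)\times\mathfrak{so}^*(3)\times\mathbb{R}\times\mathbb{R}^*\ni(A,\Pi,\alpha,l)$, $\Pi=(\Pi_1,\Pi_2,\Pi_3)\in\mathfrak{so}^*(3)\cong\mathbb{R}^3$. The constants are $\bar I_k=I_k+J_{3k}$ ($k=1,2$), $\bar I_3=I_3$, where $I_1,I_2,I_3>0$ are the principal moments of inertia of the carrier body, $J_{3k}$ is the moment of inertia of the rotor about the $k$th principal axis, and $J_3>0$ is the moment of inertia of the rotor about its rotation axis. Action: $B\cdot(A,\Pi,\alpha,l)=(BA,\Pi,\alpha,l)$, assumed free, proper and symplectic, with $\mathrm{Ad}^*$-equivariant momentum map $\mathbf{J}_Q:T^*Q\to\mathfrak{so}^*(3)$ (on the $T^*\mathrm{SO}(3)$ factor it is the momentum map of left translation, so $\mathbf{J}_Q^{-1}(\mu)\cong\mathbf{J}_{\mathrm{SO}(3)}^{-1}(\mu)\times\mathbb{R}\times\mathbb{R}^*$).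 $\mathrm{SO}(3)_\mu$ is the isotropy group of $\mu$ for the coadjoint action, $i_\mu:\mathbf{J}_Q^{-1}(\mu)\to T^*Q$ is the inclusion. The quotient $(T^*Q)_\mu=\mathbf{J}_Q^{-1}(\mu)/\mathrm{SO}(3)_\mu$, with the form $\omega_\mu$ determined by $\pi_\mu^*\omega_\mu=i_\mu^*\omega_Q$, is identified with $\mathcal{O}_\mu\times\mathbb{R}\times\mathbb{R}^*$, so that the projection is $\pi_\mu:\mathbf{J}_Q^{-1}(\mu)\to\mathcal{O}_\mu\times\mathbb{R}\times\mathbb{R}^*$, $(A,\Pi,\alpha,l)\mapsto(\Pi,\alpha,l)$. Symplectic form: $\tilde\omega^-_{\mathcal{O}_\mu\times\mathbb{R}\times\mathbb{R}^*}=\pi_{\mathcal{O}_\mu}^*\omega^-_{\mathcal{O}_\mu}+\pi_{\mathbb{R}}^*\omega_{\mathbb{R}}$, with $\pi_{\mathcal{O}_\mu},\pi_{\mathbb{R}}$ the projections to $\mathcal{O}_\mu$ and $\mathbb{R}\times\mathbb{R}^*$; $\omega^-_{\mathcal{O}_\mu}$ is the (minus) orbit symplectic form on $\mathcal{O}_\mu$, induced by the Lie–Poisson bracket $\{F,K\}(\Pi)=-\Pi\cdot(\nabla_\Pi F\times\nabla_\Pi K)$; and $\omega_{\mathbb{R}}((\theta_1,\lambda_1),(\theta_2,\lambda_2))=\langle\lambda_2,\theta_1\rangle-\langle\lambda_1,\theta_2\rangle$. Thus $\mathcal{O}_\mu\times\mathbb{R}\times\mathbb{R}^*$ is a symplectic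 leaf of $\mathfrak{so}^*(3)\times\mathbb{R}\times\mathbb{R}^*$ with bracket $$\{F,K\}_-(\Pi,\alpha,l)=-\Pi\cdot(\nabla_\Pi F\times\nabla_\Pi K)+\frac{\partial F}{\partial\alpha}\frac{\partial K}{\partial l}-\frac{\partial K}{\partial\alpha}\frac{\partial F}{\partial l}.$$ Hamiltonian vector fields: $X_{h_\mu}(K)=\tilde\omega^-(X_K,X_{h_\mu})=\{K,h_\mu\}_-$, and $X_H$ is the Hamiltonian vector field of $H$ with respect to $\omega_Q$. Controls: $W\subset T^*Q$ is a fiber submanifold (control subset), and the control $u:T^*Q\to W$ is a fiber-preserving map, assumed invariant under the cotangent lifted $\mathrm{SO}(3)$-action (i.e. compatible with the action); $u$ is assumed to take values in $W\cap\mathbf{J}_Q^{-1}(\mu)$ on $\mathbf{J}_Q^{-1}(\mu)$, and $W_\mu=\pi_\mu(W\cap\mathbf{J}_Q^{-1}(\mu))$. A regular controlled Hamiltonian (RCH) system (with no external force) is a symplectic phase space, a Hamiltonian, and a control. Its dynamical vector field is $X_H+\mathrm{vlift}(u)$, where $\mathrm{vlift}(u)=\mathrm{vlift}(u)\cdot X_H$, the change of $X_H$ under the action of $u$, is a vector field tangent to the fibers of $T^*Q\to Q$, invariant under the action and tangent to $\mathbf{J}_Q^{-1}(\mu)$ along $\mathbf{J}_Q^{-1}(\mu)$; similarly $\mathrm{vlift}(u_\mu)=\mathrm{vlift}(u_\mu)\cdot X_{h_\mu}$, the change of $X_{h_\mu}$ under the action of $u_\mu$, is the vector field on $\mathcal{O}_\mu\times\mathbb{R}\times\mathbb{R}^*$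 with $\mathrm{vlift}(u_\mu)\circ\pi_\mu=T\pi_\mu\circ\mathrm{vlift}(u)\circ i_\mu$. An RCH system on $T^*Q$ with a free, proper, symplectic action of a Lie group $G$, $\mathrm{Ad}^*$-equivariant momentum map $\mathbf{J}$, and $G$-invariant Hamiltonian and control is called regular point reducible if there is a regular value $\mu$ of $\mathbf{J}$ for which the reduced symplectic space $(\mathbf{J}^{-1}(\mu)/G_\mu,\omega_\mu)$, the reduced Hamiltonian $h_\mu$ ($h_\mu\circ\pi_\mu=H\circ i_\mu$) and the reduced control $u_\mu$ ($u_\mu\circ\pi_\mu=\pi_\mu\circ u\circ i_\mu$) form an RCH system; that system is the regular point reduced ($R_p$-reduced) system. *)

theory Defs
  imports "HOL-Analysis.Analysis"
begin

primrec Ck_on :: "nat \<Rightarrow> 'a::euclidean_space set \<Rightarrow> ('a \<Rightarrow> 'b::euclidean_space) \<Rightarrow> bool" where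
  "Ck_on 0 U f \<longleftrightarrow> continuous_on U f"
| "Ck_on (Suc k) U f \<longleftrightarrow>
     (\<forall>x\<in>U. f differentiable (at x)) \<and> (\<forall>v. Ck_on k U (\<lambda>x. frechet_derivative f (at x) v))"

text \<open>Only meaningful for open \<open>U\<close>.\<close>

definition smooth_on :: "'a::euclidean_space set \<Rightarrow> ('a \<Rightarrow> 'b::euclidean_space) \<Rightarrow> bool" where
  "smooth_on U f \<longleftrightarrow> (\<forall>k. Ck_on k U f)"

text \<open>Smoothness on an arbitrary subset of a Euclidean space, and submanifolds, as in Milnor's
  \<open>Topology from the Differentiable Viewpoint\<close>: a map is smooth if it locally extends to a smooth
  map on an open set, and a submanifold is locally diffeomorphic to an open piece of
  \<open>d\<close>-dimensional space (realised as a subspace \<open>S\<close> of the ambient space).\<close>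

definition smooth_map :: "'a::euclidean_space set \<Rightarrow> ('a \<Rightarrow> 'b::euclidean_space) \<Rightarrow> bool" where
  "smooth_map M f \<longleftrightarrow>
     (\<forall>x\<in>M. \<exists>U g. open U \<and> x \<in> U \<and> smooth_on U g \<and> (\<forall>y\<in>M \<inter> U. g y = f y))"

definition embedded_submanifold :: "nat \<Rightarrow> 'a::euclidean_space set \<Rightarrow> bool" where
  "embedded_submanifold d M \<longleftrightarrow>
     (\<forall>x\<in>M. \<exists>U (S :: 'a set) N \<phi> \<psi>. open U \<and> x \<in> U \<and> subspace S \<and> dim S = d \<and>
        openin (top_of_set S) N \<and> smooth_map N \<phi> \<and> smooth_map (M \<inter> U) \<psi> \<and>
        \<phi> ` N = M \<inter> U \<and> \<psi> ` (M \<inter> U) = N \<and>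
        (\<forall>y\<in>N. \<psi> (\<phi> y) = y) \<and> (\<forall>z\<in>M \<inter> U. \<phi> (\<psi> z) = z))"

definition curve_in :: "'a::euclidean_space set \<Rightarrow> 'a \<Rightarrow> 'a \<Rightarrow> (real \<Rightarrow> 'a) \<Rightarrow> bool" where
  "curve_in M x v \<gamma> \<longleftrightarrow> range \<gamma> \<subseteq> M \<and> \<gamma> 0 = x \<and> (\<gamma> has_vector_derivative v) (at 0)"

definition tangent_space :: "'a::euclidean_space set \<Rightarrow> 'a \<Rightarrow> 'a set" where
  "tangent_space M x = {v. \<exists>\<gamma>. curve_in M x v \<gamma>}"

definition tangent_map ::
  "'a::euclidean_space set \<Rightarrow> ('a \<Rightarrow> 'b::euclidean_space) \<Rightarrow> 'a \<Rightarrow> 'a \<Rightarrow> 'b" where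
  "tangent_map M f x v =
     (THE w. \<exists>\<gamma>. curve_in M x v \<gamma> \<and> ((f \<circ> \<gamma>) has_vector_derivative w) (at 0))"

definition vector_field :: "'a::euclidean_space set \<Rightarrow> ('a \<Rightarrow> 'a) \<Rightarrow> bool" where
  "vector_field M X \<longleftrightarrow> smooth_map M X \<and> (\<forall>x\<in>M. X x \<in> tangent_space M x)"

definition ext_deriv1 ::
  "('a::euclidean_space \<Rightarrow> 'a \<Rightarrow> real) \<Rightarrow> 'a \<Rightarrow> 'a \<Rightarrow> 'a \<Rightarrow> real" where
  "ext_deriv1 \<theta> x v w =
     frechet_derivative (\<lambda>y. \<theta> y w) (at x) v - frechet_derivative (\<lambda>y. \<theta> y v) (at x) w"

definition ext_deriv2 ::
  "('a::euclidean_space \<Rightarrow> 'a \<Rightarrow> 'a \<Rightarrow> real) \<Rightarrow> 'a \<Rightarrow> 'a \<Rightarrow> 'a \<Rightarrow> 'a \<Rightarrow> real" where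
  "ext_deriv2 \<Omega> x u v w =
     frechet_derivative (\<lambda>y. \<Omega> y v w) (at x) u - frechet_derivative (\<lambda>y. \<Omega> y u w) (at x) v
     + frechet_derivative (\<lambda>y. \<Omega> y u v) (at x) w"

text \<open>A smooth form on a submanifold is locally the restriction of a smooth form \<open>\<Omega>\<close> on an open
  subset of the ambient space, and its exterior derivative is the restriction of that of \<open>\<Omega>\<close>.
  Values of \<open>\<omega> x\<close> on vectors that are not tangent to \<open>M\<close> are irrelevant.\<close>

definition closed_two_form ::
  "'a::euclidean_space set \<Rightarrow> ('a \<Rightarrow> 'a \<Rightarrow> 'a \<Rightarrow> real) \<Rightarrow> bool" where
  "closed_two_form M \<omega> \<longleftrightarrow>
     (\<forall>x\<in>M. \<exists>U \<Omega>. open U \<and> x \<in> U \<and>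
        (\<forall>y\<in>U. bilinear (\<Omega> y) \<and> (\<forall>v. \<Omega> y v v = 0)) \<and>
        (\<forall>v w. smooth_on U (\<lambda>y. \<Omega> y v w)) \<and>
        (\<forall>y\<in>M \<inter> U. \<forall>v\<in>tangent_space M y. \<forall>w\<in>tangent_space M y. \<Omega> y v w = \<omega> y v w) \<and>
        (\<forall>y\<in>M \<inter> U. \<forall>u\<in>tangent_space M y. \<forall>v\<in>tangent_space M y. \<forall>w\<in>tangent_space M y.
            ext_deriv2 \<Omega> y u v w = 0))"

definition symplectic_manifold ::
  "'a::euclidean_space set \<Rightarrow> ('a \<Rightarrow> 'a \<Rightarrow> 'a \<Rightarrow> real) \<Rightarrow> bool" where
  "symplectic_manifold M \<omega> \<longleftrightarrow>
     (\<exists>d. embedded_submanifold d M) \<and> closed_two_form M \<omega> \<and>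
     (\<forall>x\<in>M. \<forall>v\<in>tangent_space M x. (\<forall>w\<in>tangent_space M x. \<omega> x v w = 0) \<longrightarrow> v = 0)"

text \<open>Sign convention: \<open>\<omega>(X\<^sub>H, \<cdot>) = dH\<close>, that is, \<open>X\<^sub>H(K) = \<omega>(X\<^sub>K, X\<^sub>H) = {K, H}\<close>.\<close>

definition ham_vf ::
  "'a::euclidean_space set \<Rightarrow> ('a \<Rightarrow> 'a \<Rightarrow> 'a \<Rightarrow> real) \<Rightarrow> ('a \<Rightarrow> real) \<Rightarrow> 'a \<Rightarrow> 'a" where
  "ham_vf M \<omega> H x =
     (THE v. v \<in> tangent_space M x \<and> (\<forall>w\<in>tangent_space M x. \<omega> x v w = tangent_map M H x w))"

abbreviation SO3 :: "(real^3^3) set" where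
  "SO3 \<equiv> {A. rotation_matrix A}"

definition hat :: "real^3 \<Rightarrow> real^3^3" where
  "hat \<xi> = matrix (\<lambda>v. cross3 \<xi> v)"

text \<open>Inverse of \<open>hat\<close> on skew matrices, extended to all matrices through the skew part.\<close>

definition vee :: "real^3^3 \<Rightarrow> real^3" where
  "vee M = (1/2) *\<^sub>R vector [M$3$2 - M$2$3, M$1$3 - M$3$1, M$2$1 - M$1$2]"

text \<open>With \<open>so(3)\<close> and its dual both identified with \<open>\<real>\<^sup>3\<close> (pairing by the dot product),
  \<open>coAd B\<close> is \<open>Ad\<close>-star of the inverse of \<open>B\<close>, i.e. the left coadjoint action.\<close>

definition Ad :: "real^3^3 \<Rightarrow> real^3 \<Rightarrow> real^3" where
  "Ad B \<xi> = vee (B ** hat \<xi> ** transpose B)"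

definition coAd :: "real^3^3 \<Rightarrow> real^3 \<Rightarrow> real^3" where
  "coAd B = adjoint (Ad (transpose B))"

definition coadjoint_orbit :: "real^3 \<Rightarrow> (real^3) set" where
  "coadjoint_orbit \<mu> = (\<lambda>B. coAd B \<mu>) ` SO3"

definition isotropy :: "real^3 \<Rightarrow> (real^3^3) set" where
  "isotropy \<mu> = {B \<in> SO3. coAd B \<mu> = \<mu>}"

definition smooth_left_action ::
  "'a::euclidean_space set \<Rightarrow> (real^3^3 \<Rightarrow> 'a \<Rightarrow> 'a) \<Rightarrow> bool" where
  "smooth_left_action M \<Phi> \<longleftrightarrow>
     (\<forall>B\<in>SO3. \<Phi> B \<in> M \<rightarrow> M) \<and> (\<forall>x\<in>M. \<Phi> (mat 1) x = x) \<and>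
     (\<forall>B\<in>SO3. \<forall>C\<in>SO3. \<forall>x\<in>M. \<Phi> (B ** C) x = \<Phi> B (\<Phi> C x)) \<and>
     smooth_map (SO3 \<times> M) (\<lambda>(B, x). \<Phi> B x)"

definition free_action :: "'a set \<Rightarrow> (real^3^3 \<Rightarrow> 'a \<Rightarrow> 'a) \<Rightarrow> bool" where
  "free_action M \<Phi> \<longleftrightarrow> (\<forall>B\<in>SO3. \<forall>x\<in>M. \<Phi> B x = x \<longrightarrow> B = mat 1)"

definition proper_action ::
  "'a::euclidean_space set \<Rightarrow> (real^3^3 \<Rightarrow> 'a \<Rightarrow> 'a) \<Rightarrow> bool" where
  "proper_action M \<Phi> \<longleftrightarrow>
     proper_map (top_of_set (SO3 \<times> M)) (top_of_set (M \<times> M)) (\<lambda>(B, x). (\<Phi> B x, x))"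

definition symplectic_action ::
  "'a::euclidean_space set \<Rightarrow> ('a \<Rightarrow> 'a \<Rightarrow> 'a \<Rightarrow> real) \<Rightarrow> (real^3^3 \<Rightarrow> 'a \<Rightarrow> 'a) \<Rightarrow> bool" where
  "symplectic_action M \<omega> \<Phi> \<longleftrightarrow>
     (\<forall>B\<in>SO3. \<forall>x\<in>M. \<forall>v\<in>tangent_space M x. \<forall>w\<in>tangent_space M x.
        \<omega> (\<Phi> B x) (tangent_map M (\<Phi> B) x v) (tangent_map M (\<Phi> B) x w) = \<omega> x v w)"

definition inf_generator :: "(real^3^3 \<Rightarrow> 'a \<Rightarrow> 'a) \<Rightarrow> real^3 \<Rightarrow> 'a \<Rightarrow> 'a::euclidean_space" where
  "inf_generator \<Phi> \<xi> x = tangent_map SO3 (\<lambda>B. \<Phi> B x) (mat 1) (hat \<xi>)"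

definition equivariant_momentum_map ::
  "'a::euclidean_space set \<Rightarrow> ('a \<Rightarrow> 'a \<Rightarrow> 'a \<Rightarrow> real) \<Rightarrow> (real^3^3 \<Rightarrow> 'a \<Rightarrow> 'a)
    \<Rightarrow> ('a \<Rightarrow> real^3) \<Rightarrow> bool" where
  "equivariant_momentum_map M \<omega> \<Phi> J \<longleftrightarrow>
     smooth_map M J \<and>
     (\<forall>\<xi>. \<forall>x\<in>M. \<forall>v\<in>tangent_space M x.
        \<omega> x (inf_generator \<Phi> \<xi> x) v = tangent_map M (\<lambda>y. J y \<bullet> \<xi>) x v) \<and>
     (\<forall>B\<in>SO3. \<forall>x\<in>M. J (\<Phi> B x) = coAd B (J x))"

definition regular_value ::
  "'a::euclidean_space set \<Rightarrow> ('a \<Rightarrow> 'b::euclidean_space) \<Rightarrow> 'b \<Rightarrow> bool" where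
  "regular_value M J \<mu> \<longleftrightarrow>
     (\<forall>x\<in>M. J x = \<mu> \<longrightarrow> tangent_map M J x ` tangent_space M x = UNIV)"

definition level_set :: "'a set \<Rightarrow> ('a \<Rightarrow> 'b) \<Rightarrow> 'b \<Rightarrow> 'a set" where
  "level_set M J \<mu> = {x \<in> M. J x = \<mu>}"

text \<open>Throughout, \<open>p\<close> is the bundle projection of the phase space \<open>M\<close>, given by its values.\<close>

definition fiber_submanifold ::
  "'a::euclidean_space set \<Rightarrow> ('a \<Rightarrow> 'b) \<Rightarrow> 'a set \<Rightarrow> bool" where
  "fiber_submanifold M p W \<longleftrightarrow>
     W \<subseteq> M \<and> (\<exists>d. embedded_submanifold d W) \<and>
     (\<forall>x\<in>W. \<exists>d. embedded_submanifold d {y \<in> W. p y = p x})"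

definition control ::
  "'a::euclidean_space set \<Rightarrow> ('a \<Rightarrow> 'b) \<Rightarrow> 'a set \<Rightarrow> ('a \<Rightarrow> 'a) \<Rightarrow> bool" where
  "control M p W u \<longleftrightarrow>
     W \<subseteq> M \<and> u \<in> M \<rightarrow> W \<and> smooth_map M u \<and> (\<forall>x\<in>M. p (u x) = p x)"

definition RCH_system ::
  "'a::euclidean_space set \<Rightarrow> ('a \<Rightarrow> 'b) \<Rightarrow> ('a \<Rightarrow> 'a \<Rightarrow> 'a \<Rightarrow> real) \<Rightarrow> ('a \<Rightarrow> real)
    \<Rightarrow> 'a set \<Rightarrow> ('a \<Rightarrow> 'a) \<Rightarrow> bool" where
  "RCH_system M p \<omega> H W u \<longleftrightarrow>
     symplectic_manifold M \<omega> \<and> smooth_map M H \<and> control M p W u"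

text \<open>Dynamical vector field, where \<open>V\<close> is \<open>vlift(u)\<close>, the change of \<open>X\<^sub>H\<close> under the control.\<close>

definition dynamical_vf ::
  "'a::euclidean_space set \<Rightarrow> ('a \<Rightarrow> 'a \<Rightarrow> 'a \<Rightarrow> real) \<Rightarrow> ('a \<Rightarrow> real) \<Rightarrow> ('a \<Rightarrow> 'a) \<Rightarrow> 'a \<Rightarrow> 'a" where
  "dynamical_vf M \<omega> H V x = ham_vf M \<omega> H x + V x"

text \<open>\<open>(N, \<omega>\<^sub>N)\<close> with projection \<open>\<pi>\<close> is a model of the reduced symplectic space: \<open>\<pi>\<close> is a surjective
  submersion of the level set whose fibers are the orbits of the isotropy group (this determines
  the smooth structure of the quotient), and \<open>\<pi>\<close> pulls \<open>\<omega>\<^sub>N\<close> back to the restriction of \<open>\<omega>\<close>.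
  The bundle projection \<open>q\<close> of \<open>N\<close> is the one that \<open>p\<close> induces on the quotient.\<close>

definition reduced_space ::
  "'a::euclidean_space set \<Rightarrow> ('a \<Rightarrow> 'b) \<Rightarrow> ('a \<Rightarrow> 'a \<Rightarrow> 'a \<Rightarrow> real) \<Rightarrow> (real^3^3 \<Rightarrow> 'a \<Rightarrow> 'a)
    \<Rightarrow> ('a \<Rightarrow> real^3) \<Rightarrow> real^3 \<Rightarrow> ('a \<Rightarrow> 'c::euclidean_space)
    \<Rightarrow> 'c set \<Rightarrow> ('c \<Rightarrow> 'd) \<Rightarrow> ('c \<Rightarrow> 'c \<Rightarrow> 'c \<Rightarrow> real) \<Rightarrow> bool" where
  "reduced_space M p \<omega> \<Phi> J \<mu> \<pi> N q \<omega>N \<longleftrightarrow>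
     (let L = level_set M J \<mu> in
      symplectic_manifold N \<omega>N \<and> smooth_map L \<pi> \<and> \<pi> ` L = N \<and>
      (\<forall>x\<in>L. tangent_map L \<pi> x ` tangent_space L x = tangent_space N (\<pi> x)) \<and>
      (\<forall>x\<in>L. \<forall>y\<in>L. \<pi> x = \<pi> y \<longleftrightarrow> (\<exists>B\<in>isotropy \<mu>. y = \<Phi> B x)) \<and>
      (\<forall>x\<in>L. \<forall>v\<in>tangent_space L x. \<forall>w\<in>tangent_space L x.
         \<omega>N (\<pi> x) (tangent_map L \<pi> x v) (tangent_map L \<pi> x w) = \<omega> x v w) \<and>
      (\<forall>x\<in>L. \<forall>y\<in>L. q (\<pi> x) = q (\<pi> y) \<longleftrightarrow> (\<exists>B\<in>isotropy \<mu>. p y = p (\<Phi> B x))))"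

definition Rp_reduced_system ::
  "'a::euclidean_space set \<Rightarrow> ('a \<Rightarrow> 'b) \<Rightarrow> ('a \<Rightarrow> 'a \<Rightarrow> 'a \<Rightarrow> real) \<Rightarrow> (real^3^3 \<Rightarrow> 'a \<Rightarrow> 'a)
    \<Rightarrow> ('a \<Rightarrow> real^3) \<Rightarrow> ('a \<Rightarrow> real) \<Rightarrow> 'a set \<Rightarrow> ('a \<Rightarrow> 'a) \<Rightarrow> real^3 \<Rightarrow> ('a \<Rightarrow> 'c::euclidean_space)
    \<Rightarrow> 'c set \<Rightarrow> ('c \<Rightarrow> 'd) \<Rightarrow> ('c \<Rightarrow> 'c \<Rightarrow> 'c \<Rightarrow> real) \<Rightarrow> ('c \<Rightarrow> real) \<Rightarrow> 'c set \<Rightarrow> ('c \<Rightarrow> 'c) \<Rightarrow> bool" where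
  "Rp_reduced_system M p \<omega> \<Phi> J H W u \<mu> \<pi> N q \<omega>N h Wm um \<longleftrightarrow>
     (let L = level_set M J \<mu> in
      regular_value M J \<mu> \<and> reduced_space M p \<omega> \<Phi> J \<mu> \<pi> N q \<omega>N \<and>
      (\<forall>x\<in>L. h (\<pi> x) = H x) \<and>
      u ` L \<subseteq> W \<inter> L \<and> Wm = \<pi> ` (W \<inter> L) \<and> (\<forall>x\<in>L. um (\<pi> x) = \<pi> (u x)) \<and>
      RCH_system N q \<omega>N h Wm um)"

text \<open>The reduced space is required to have a model inside \<open>\<real>\<^sup>3 \<times> \<real> \<times> \<real>\<close>, since a definition cannot
  quantify over the type of the ambient space.\<close>

type_synonym reduced = "(real^3) \<times> real \<times> real"

definition regular_point_reducible ::
  "'a::euclidean_space set \<Rightarrow> ('a \<Rightarrow> 'b) \<Rightarrow> ('a \<Rightarrow> 'a \<Rightarrow> 'a \<Rightarrow> real) \<Rightarrow> (real^3^3 \<Rightarrow> 'a \<Rightarrow> 'a)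
    \<Rightarrow> ('a \<Rightarrow> real^3) \<Rightarrow> ('a \<Rightarrow> real) \<Rightarrow> 'a set \<Rightarrow> ('a \<Rightarrow> 'a) \<Rightarrow> bool" where
  "regular_point_reducible M p \<omega> \<Phi> J H W u \<longleftrightarrow>
     RCH_system M p \<omega> H W u \<and> fiber_submanifold M p W \<and>
     smooth_left_action M \<Phi> \<and> free_action M \<Phi> \<and> proper_action M \<Phi> \<and> symplectic_action M \<omega> \<Phi> \<and>
     equivariant_momentum_map M \<omega> \<Phi> J \<and>
     (\<forall>B\<in>SO3. \<forall>x\<in>M. H (\<Phi> B x) = H x) \<and>
     (\<forall>B\<in>SO3. \<forall>x\<in>M. u (\<Phi> B x) = \<Phi> B (u x)) \<and>
     (\<exists>\<mu> \<pi> (N :: reduced set) (q :: reduced \<Rightarrow> (real^3) \<times> real) \<omega>N h Wm um.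
        Rp_reduced_system M p \<omega> \<Phi> J H W u \<mu> \<pi> N q \<omega>N h Wm um)"

text \<open>\<open>descend L \<pi> f\<close> is the map \<open>f'\<close> on \<open>\<pi> ` L\<close> with \<open>f' \<circ> \<pi> = f\<close> on \<open>L\<close>, provided that \<open>f\<close> is
  constant on the fibers of \<open>\<pi>\<close>.\<close>

definition descend :: "'a set \<Rightarrow> ('a \<Rightarrow> 'c) \<Rightarrow> ('a \<Rightarrow> 'e) \<Rightarrow> 'c \<Rightarrow> 'e" where
  "descend L \<pi> f y = f (inv_into L \<pi> y)"

text \<open>Points \<open>(A, P, \<alpha>, l)\<close> of \<open>T\<^sup>*Q\<close> in left trivialization; \<open>P\<close> is the body angular momentum.\<close>

type_synonym phase = "(real^3^3) \<times> (real^3) \<times> real \<times> real"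

definition TQ :: "phase set" where
  "TQ = SO3 \<times> UNIV"

definition base_TQ :: "phase \<Rightarrow> (real^3^3) \<times> real" where
  "base_TQ = (\<lambda>(A, P, \<alpha>, l). (A, \<alpha>))"

definition act_TQ :: "real^3^3 \<Rightarrow> phase \<Rightarrow> phase" where
  "act_TQ B = (\<lambda>(A, P, \<alpha>, l). (B ** A, P, \<alpha>, l))"

text \<open>The canonical one-form pairs the covector \<open>(P, l)\<close> with the projection to \<open>TQ\<close> of the
  tangent vector; the velocity of \<open>A\<close> is first left-translated to the identity.\<close>

definition canonical_one_form :: "phase \<Rightarrow> phase \<Rightarrow> real" where
  "canonical_one_form = (\<lambda>(A, P, \<alpha>, l) (A', P', \<alpha>', l'). P \<bullet> vee (transpose A ** A') + l * \<alpha>')"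

text \<open>Minus the exterior derivative, as for \<open>dq \<and> dp\<close>. It is taken in the ambient space; on vectors
  tangent to \<open>TQ\<close> it does not depend on the extension of \<open>canonical_one_form\<close>.\<close>

definition omega_Q :: "phase \<Rightarrow> phase \<Rightarrow> phase \<Rightarrow> real" where
  "omega_Q x v w = - ext_deriv1 canonical_one_form x v w"

text \<open>Momentum map of the cotangent lift: \<open>\<langle>J x, \<xi>\<rangle>\<close> is the canonical one-form evaluated at the
  infinitesimal generator of \<open>\<xi>\<close>, which gives \<open>J x \<bullet> \<xi> = P \<bullet> (A\<^sup>T \<xi>)\<close>.\<close>

definition J_Q :: "phase \<Rightarrow> real^3" where
  "J_Q = (\<lambda>(A, P, \<alpha>, l). A *v P)"

definition Ham ::
  "real \<Rightarrow> real \<Rightarrow> real \<Rightarrow> real \<Rightarrow> real \<Rightarrow> real \<Rightarrow> phase \<Rightarrow> real" where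
  "Ham I1 I2 I3 J31 J32 J3 = (\<lambda>(A, P, \<alpha>, l).
     (1/2) * ((P$1)\<^sup>2 / (I1 + J31) + (P$2)\<^sup>2 / (I2 + J32) + (P$3 - l)\<^sup>2 / I3 + l\<^sup>2 / J3))"

definition orbit_space :: "real^3 \<Rightarrow> reduced set" where
  "orbit_space \<mu> = coadjoint_orbit \<mu> \<times> UNIV"

definition proj_red :: "phase \<Rightarrow> reduced" where
  "proj_red = (\<lambda>(A, P, \<alpha>, l). (P, \<alpha>, l))"

text \<open>The quotient of \<open>Q = SO(3) \<times> \<real>\<close> by the isotropy group of \<open>\<mu>\<close> is the product of the orbit and \<open>\<real>\<close>.\<close>

definition base_red :: "reduced \<Rightarrow> (real^3) \<times> real" where
  "base_red = (\<lambda>(P, \<alpha>, l). (P, \<alpha>))"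

text \<open>The vector \<open>P \<times> \<xi>\<close> is the Lie-Poisson Hamiltonian vector field at \<open>P\<close> of any function with gradient
  \<open>\<xi>\<close>, so the defining equation is \<open>\<omega>\<^sup>-(X\<^sub>F, X\<^sub>K) = {F, K} = - P \<bullet> (\<nabla>F \<times> \<nabla>K)\<close>.\<close>

definition orbit_form_minus :: "real^3 \<Rightarrow> real^3 \<Rightarrow> real^3 \<Rightarrow> real" where
  "orbit_form_minus P v w =
     (THE c. \<exists>\<xi> \<eta>. v = cross3 P \<xi> \<and> w = cross3 P \<eta> \<and> c = - (P \<bullet> cross3 \<xi> \<eta>))"

definition omega_red :: "reduced \<Rightarrow> reduced \<Rightarrow> reduced \<Rightarrow> real" where
  "omega_red = (\<lambda>(P, \<alpha>, l) (v1, \<theta>1, l1) (v2, \<theta>2, l2).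
     orbit_form_minus P v1 v2 + (l2 * \<theta>1 - l1 * \<theta>2))"

end

(* The level set L of the momentum map A P at mu has tangent vectors (A hat xi, P x xi, a', l'), on which
   the canonical form of T*Q restricts to - P . (xi x eta) + (l2 a1 - l1 a2). This only involves the image
   under (A, P, a, l) -> (P, a, l), and it is the minus orbit form plus the canonical form of R x R*.
   For H = k(P, a, l) the Hamiltonian vector fields are (A hat g, P x g, k_l, - k_a) upstairs and
   (P x g, k_l, - k_a) downstairs, g being the P-gradient of k, so one projects to the other.
   SO(3) is charted by the Cayley transform, the orbits (spheres) by stereographic projection; smoothness
   descends to the quotient through local sections of L over the sphere, given by the rotation
   cay ((P0 x P) / (P0 . P0 + P0 . P)), which takes P0 to P. *)

theory Submission
  imports Defs
begin

subsection \<open>Calculus of smooth maps\<close>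

text \<open>Tangent maps, Hamiltonian vector fields and the orbit form are definite descriptions, so
  each value needs an existence and a uniqueness argument. Both rest on explicit descriptions of
  three tangent spaces, those of \<open>TQ\<close>, of the level set and of the orbit space: a
  defining equation bounds each from above, and curves built from the Cayley transform fill it from
  below. The Cayley transform is chosen because it and its inverse are rational. Smoothness then
  follows from closure under sums, products and quotients, and the group identities become
  polynomial identities. The value \<mu> = 0 stays admissible throughout. Every rotation is
  invertible, so \<open>J_Q\<close> is a submersion there too, although the orbit collapses to a
  point; the charts of spheres, the local sections and the tangent space of the orbit treat this
  case separately. The lift \<open>V\<close> enters abstractly, as a smooth equivariant field
  tangent to the level set. Its reduced field is obtained by descent, and the projection of the
  dynamics follows from that of the Hamiltonian part because \<open>proj_red\<close> is
  linear.\<close>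

lemma Ck_on_cong:
  assumes "open U" "\<And>x. x \<in> U \<Longrightarrow> f x = g x" "Ck_on k U f"
  shows "Ck_on k U g"
  using assms(2,3)
proof (induction k arbitrary: f g)
  case 0
  then show ?case by (simp cong: continuous_on_cong)
next
  case (Suc k)
  have d: "f differentiable at x \<Longrightarrow> x \<in> U \<Longrightarrow> g differentiable at x" for x
    using Suc.prems(1) \<open>open U\<close> unfolding differentiable_def
    by (meson has_derivative_transform_within_open)
  have fd: "frechet_derivative f (at x) = frechet_derivative g (at x)" if "x \<in> U" for x
    using Suc.prems \<open>open U\<close> that
    by (intro frechet_derivative_transform_within_open[of f x U g]) auto
  show ?case
    using Suc.prems(2) d fd by (auto intro: Suc.IH[rotated])
qed

text \<open>\<open>Ck_on\<close> is defined through \<open>frechet_derivative\<close>; this rule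
  accepts any formula for the derivative, which lets the closure properties below run by induction
  on the order.\<close>

lemma Ck_on_SucI:
  assumes "open U" "\<And>x. x \<in> U \<Longrightarrow> (f has_derivative f' x) (at x)"
    and "\<And>v. Ck_on k U (\<lambda>x. f' x v)"
  shows "Ck_on (Suc k) U f"
proof -
  have "f' x = frechet_derivative f (at x)" if "x \<in> U" for x
    using assms(2)[OF that] frechet_derivative_at by blast
  then have "Ck_on k U (\<lambda>x. frechet_derivative f (at x) v)" for v
    by (intro Ck_on_cong[OF \<open>open U\<close> _ assms(3)[of v]]) simp
  then show ?thesis
    using assms(2) by (auto simp: differentiable_def)
qed

lemma Ck_on_has_derivative:
  "Ck_on (Suc k) U f \<Longrightarrow> x \<in> U \<Longrightarrow> (f has_derivative frechet_derivative f (at x)) (at x)"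
  by (simp add: frechet_derivative_works)

text \<open>Differentiability gives continuity, which starts the induction; the step applies the
  hypothesis to every directional derivative.\<close>

lemma Ck_on_SucD: "Ck_on (Suc k) U f \<Longrightarrow> Ck_on k U f"
proof (induction k arbitrary: f)
  case 0
  then show ?case
    by (auto intro!: continuous_at_imp_continuous_on differentiable_imp_continuous_within)
next
  case (Suc k)
  then show ?case
    unfolding Ck_on.simps(2)[of "Suc k"] Ck_on.simps(2)[of k U f] by blast
qed

lemma Ck_on_subset: "Ck_on k U f \<Longrightarrow> V \<subseteq> U \<Longrightarrow> Ck_on k V f"
  by (induction k arbitrary: f) (auto intro: continuous_on_subset)

lemma Ck_on_const: "Ck_on k U (\<lambda>x. c)"
  by (induction k arbitrary: c) simp_all

lemma Ck_on_bounded_linear: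
  assumes "open U" "bounded_linear h" "Ck_on k U f"
  shows "Ck_on k U (\<lambda>x. h (f x))"
  using assms(3)
proof (induction k arbitrary: f)
  case 0
  then show ?case
    using assms(2) by (simp add: bounded_linear.continuous_on)
next
  case (Suc k)
  show ?case
  proof (rule Ck_on_SucI[OF \<open>open U\<close>])
    show "((\<lambda>x. h (f x)) has_derivative (\<lambda>v. h (frechet_derivative f (at x) v))) (at x)"
      if "x \<in> U" for x
      by (rule bounded_linear.has_derivative[OF assms(2) Ck_on_has_derivative[OF Suc.prems that]])
    show "Ck_on k U (\<lambda>x. h (frechet_derivative f (at x) v))" for v
      using Suc.prems by (intro Suc.IH) simp
  qed
qed

lemma Ck_on_add:
  assumes "open U" "Ck_on k U f" "Ck_on k U g"
  shows "Ck_on k U (\<lambda>x. f x + g x)"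
  using assms(2,3)
proof (induction k arbitrary: f g)
  case 0
  then show ?case by (simp add: continuous_on_add)
next
  case (Suc k)
  show ?case
  proof (rule Ck_on_SucI[OF \<open>open U\<close>])
    show "((\<lambda>x. f x + g x) has_derivative
        (\<lambda>v. frechet_derivative f (at x) v + frechet_derivative g (at x) v)) (at x)"
      if "x \<in> U" for x
      using Ck_on_has_derivative[OF Suc.prems(1) that] Ck_on_has_derivative[OF Suc.prems(2) that]
      by (rule has_derivative_add)
    show "Ck_on k U (\<lambda>x. frechet_derivative f (at x) v + frechet_derivative g (at x) v)" for v
      using Suc.prems by (intro Suc.IH) simp_all
  qed
qed

lemma Ck_on_sum:
  assumes "open U" "\<And>i. i \<in> I \<Longrightarrow> Ck_on k U (f i)"
  shows "Ck_on k U (\<lambda>x. \<Sum>i\<in>I. f i x)"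
  using assms(2)
  by (induction I rule: infinite_finite_induct) (auto intro: Ck_on_const Ck_on_add[OF \<open>open U\<close>])

lemma Ck_on_bounded_bilinear:
  assumes "open U" "bounded_bilinear h" "Ck_on k U f" "Ck_on k U g"
  shows "Ck_on k U (\<lambda>x. h (f x) (g x))"
  using assms(3,4)
proof (induction k arbitrary: f g)
  case 0
  then show ?case
    using assms(2) by (simp add: bounded_bilinear.continuous_on)
next
  case (Suc k)
  show ?case
  proof (rule Ck_on_SucI[OF \<open>open U\<close>])
    show "((\<lambda>x. h (f x) (g x)) has_derivative
        (\<lambda>v. h (f x) (frechet_derivative g (at x) v) + h (frechet_derivative f (at x) v) (g x))) (at x)"
      if "x \<in> U" for x
      using Ck_on_has_derivative[OF Suc.prems(1) that] Ck_on_has_derivative[OF Suc.prems(2) that]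
      by (rule bounded_bilinear.FDERIV[OF assms(2)])
    show "Ck_on k U (\<lambda>x. h (f x) (frechet_derivative g (at x) v)
        + h (frechet_derivative f (at x) v) (g x))" for v
      \<comment> \<open>Each term of the product rule contains one undifferentiated factor, whose
        order has to be lowered to \<open>k\<close> for the induction hypothesis.\<close>
      using Suc.prems Suc.prems[THEN Ck_on_SucD] by (intro Ck_on_add[OF \<open>open U\<close>] Suc.IH) auto
  qed
qed

text \<open>The chain rule evaluates the derivative of \<open>f\<close> in a direction that varies
  with \<open>x\<close>, while \<open>Ck_on\<close> controls fixed directions. Expanding the
  direction in the basis gives a finite sum of scalar functions times derivatives in fixed
  directions, and the induction hypothesis covers the latter.\<close>

lemma Ck_on_compose:
  assumes "open U" "open T" "Ck_on k T f" "Ck_on k U g" "g ` U \<subseteq> T"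
  shows "Ck_on k U (\<lambda>x. f (g x))"
  using assms(3,4)
proof (induction k arbitrary: f)
  case 0
  then show ?case
    using assms(5) by (auto intro: continuous_on_compose2)
next
  case (Suc k)
  show ?case
  proof (rule Ck_on_SucI[OF \<open>open U\<close>])
    fix x assume "x \<in> U"
    let ?f' = "frechet_derivative f (at (g x))" and ?g' = "frechet_derivative g (at x)"
    have f': "(f has_derivative ?f') (at (g x))"
      using Ck_on_has_derivative[OF Suc.prems(1)] \<open>x \<in> U\<close> assms(5) by blast
    have "((\<lambda>x. f (g x)) has_derivative (\<lambda>v. ?f' (?g' v))) (at x)"
      using has_derivative_compose[OF Ck_on_has_derivative[OF Suc.prems(2) \<open>x \<in> U\<close>] f'] .
    moreover have "?f' (?g' v) = (\<Sum>b\<in>Basis. (?g' v \<bullet> b) *\<^sub>R ?f' b)" for v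
    proof -
      have "?f' (?g' v) = ?f' (\<Sum>b\<in>Basis. (?g' v \<bullet> b) *\<^sub>R b)"
        by (simp add: euclidean_representation)
      also have "\<dots> = (\<Sum>b\<in>Basis. (?g' v \<bullet> b) *\<^sub>R ?f' b)"
        using has_derivative_linear[OF f'] by (simp add: linear_sum linear_scale)
      finally show ?thesis .
    qed
    ultimately show "((\<lambda>x. f (g x)) has_derivative
        (\<lambda>v. \<Sum>b\<in>Basis. (?g' v \<bullet> b) *\<^sub>R ?f' b)) (at x)"
      by simp
  next
    fix v
    have "Ck_on k U (\<lambda>x. frechet_derivative f (at (g x)) b)" for b
      using Suc.prems(1) Ck_on_SucD[OF Suc.prems(2)] by (intro Suc.IH) auto
    moreover have "Ck_on k U (\<lambda>x. frechet_derivative g (at x) v \<bullet> b)" for b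
      using Suc.prems
      by (intro Ck_on_bounded_linear[OF \<open>open U\<close> bounded_linear_inner_left]) auto
    ultimately show "Ck_on k U (\<lambda>x. \<Sum>b\<in>Basis.
        (frechet_derivative g (at x) v \<bullet> b) *\<^sub>R frechet_derivative f (at (g x)) b)"
      by (intro Ck_on_sum[OF \<open>open U\<close>]
          Ck_on_bounded_bilinear[OF \<open>open U\<close> bounded_bilinear_scaleR]) auto
  qed
qed

text \<open>The derivative of the reciprocal is built from the reciprocal itself and from
  \<open>f'\<close>, both known to have order \<open>k\<close> in the induction step.\<close>

lemma Ck_on_inverse:
  fixes f :: "'a::euclidean_space \<Rightarrow> real"
  assumes "open U" "Ck_on k U f" "\<And>x. x \<in> U \<Longrightarrow> f x \<noteq> 0"
  shows "Ck_on k U (\<lambda>x. inverse (f x))"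
  using assms(2)
proof (induction k)
  case 0
  then show ?case
    using assms(3) by (simp add: continuous_on_inverse)
next
  case (Suc k)
  show ?case
  proof (rule Ck_on_SucI[OF \<open>open U\<close>])
    show "((\<lambda>x. inverse (f x)) has_derivative
        (\<lambda>v. - 1 * (inverse (f x) * frechet_derivative f (at x) v * inverse (f x)))) (at x)"
      if "x \<in> U" for x
      using Deriv.has_derivative_inverse[OF assms(3)[OF that] Ck_on_has_derivative[OF Suc.prems that]]
      by simp
    have "Ck_on k U (\<lambda>x. inverse (f x))"
      by (rule Suc.IH[OF Ck_on_SucD[OF Suc.prems]])
    then show "Ck_on k U (\<lambda>x. - 1 * (inverse (f x) * frechet_derivative f (at x) v * inverse (f x)))"
      for v
      using Suc.prems
      by (intro Ck_on_bounded_bilinear[OF \<open>open U\<close> bounded_bilinear_mult] Ck_on_const) auto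
  qed
qed

section \<open>Closure properties of smooth functions on open sets\<close>

lemma smooth_on_const: "smooth_on U (\<lambda>x. c)"
  by (simp add: smooth_on_def Ck_on_const)

lemma smooth_on_ident:
  assumes "open U"
  shows "smooth_on U (\<lambda>x. x)"
proof -
  have "Ck_on k U (\<lambda>x. x)" for k
  proof (cases k)
    case (Suc k)
    then show ?thesis
      using Ck_on_SucI[OF assms, of "\<lambda>x. x" "\<lambda>_ v. v" k] Ck_on_const by auto
  qed simp
  then show ?thesis by (simp add: smooth_on_def)
qed

lemma smooth_on_subset: "smooth_on U f \<Longrightarrow> V \<subseteq> U \<Longrightarrow> smooth_on V f"
  by (auto simp: smooth_on_def intro: Ck_on_subset)

lemma smooth_on_linear:
  assumes "open U" "linear h" "smooth_on U f"
  shows "smooth_on U (\<lambda>x. h (f x))"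
  using assms Ck_on_bounded_linear[OF \<open>open U\<close>, of h]
  by (auto simp: smooth_on_def linear_conv_bounded_linear)

lemma smooth_on_bilinear:
  assumes "open U" "bilinear h" "smooth_on U f" "smooth_on U g"
  shows "smooth_on U (\<lambda>x. h (f x) (g x))"
  using assms Ck_on_bounded_bilinear[OF \<open>open U\<close>, of h]
  by (auto simp: smooth_on_def bilinear_conv_bounded_bilinear)

lemma smooth_on_add:
  "open U \<Longrightarrow> smooth_on U f \<Longrightarrow> smooth_on U g \<Longrightarrow> smooth_on U (\<lambda>x. f x + g x)"
  by (auto simp: smooth_on_def intro: Ck_on_add)

lemma smooth_on_compose:
  assumes "open U" "open T" "smooth_on T f" "smooth_on U g" "g ` U \<subseteq> T"
  shows "smooth_on U (\<lambda>x. f (g x))"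
  using assms Ck_on_compose unfolding smooth_on_def by blast

lemma smooth_on_inverse:
  fixes f :: "'a::euclidean_space \<Rightarrow> real"
  assumes "open U" "smooth_on U f" "\<And>x. x \<in> U \<Longrightarrow> f x \<noteq> 0"
  shows "smooth_on U (\<lambda>x. inverse (f x))"
  using assms by (auto simp: smooth_on_def intro: Ck_on_inverse)

lemma smooth_on_minus: "open U \<Longrightarrow> smooth_on U f \<Longrightarrow> smooth_on U (\<lambda>x. - f x)"
  by (rule smooth_on_linear) (auto simp: module_hom_uminus linear_iff)

lemma smooth_on_diff:
  "open U \<Longrightarrow> smooth_on U f \<Longrightarrow> smooth_on U g \<Longrightarrow> smooth_on U (\<lambda>x. f x - g x)"
  using smooth_on_add[of U f "\<lambda>x. - g x"] smooth_on_minus[of U g] by simp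

lemma smooth_on_mult:
  fixes f g :: "'a::euclidean_space \<Rightarrow> real"
  shows "open U \<Longrightarrow> smooth_on U f \<Longrightarrow> smooth_on U g \<Longrightarrow> smooth_on U (\<lambda>x. f x * g x)"
  by (rule smooth_on_bilinear[where h = "(*)"])
    (auto simp: bilinear_conv_bounded_bilinear bounded_bilinear_mult)

lemma smooth_on_power2:
  fixes f :: "'a::euclidean_space \<Rightarrow> real"
  shows "open U \<Longrightarrow> smooth_on U f \<Longrightarrow> smooth_on U (\<lambda>x. (f x)\<^sup>2)"
  by (simp add: power2_eq_square smooth_on_mult)

lemma smooth_on_divide:
  fixes f g :: "'a::euclidean_space \<Rightarrow> real"
  assumes "open U" "smooth_on U f" "smooth_on U g" "\<And>x. x \<in> U \<Longrightarrow> g x \<noteq> 0"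
  shows "smooth_on U (\<lambda>x. f x / g x)"
  unfolding divide_inverse
  using assms by (intro smooth_on_mult smooth_on_inverse) auto

lemma smooth_on_scaleR:
  "open U \<Longrightarrow> smooth_on U f \<Longrightarrow> smooth_on U g \<Longrightarrow> smooth_on U (\<lambda>x. f x *\<^sub>R g x)"
  by (rule smooth_on_bilinear[where h = scaleR])
    (auto simp: bilinear_conv_bounded_bilinear bounded_bilinear_scaleR)

lemma smooth_on_inner:
  "open U \<Longrightarrow> smooth_on U f \<Longrightarrow> smooth_on U g \<Longrightarrow> smooth_on U (\<lambda>x. f x \<bullet> g x)"
  by (rule smooth_on_bilinear[where h = inner])
    (auto simp: bilinear_conv_bounded_bilinear bounded_bilinear_inner)

lemma smooth_on_Pair:
  assumes "open U" "smooth_on U f" "smooth_on U g"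
  shows "smooth_on U (\<lambda>x. (f x, g x))"
proof -
  have "smooth_on U (\<lambda>x. (f x, 0) + (0, g x))"
    using assms
    by (intro smooth_on_add smooth_on_linear[where h = "\<lambda>y. (y, 0)"]
        smooth_on_linear[where h = "\<lambda>y. (0, y)"]) (auto simp: linear_iff)
  then show ?thesis by simp
qed

lemma smooth_on_fst: "open U \<Longrightarrow> smooth_on U f \<Longrightarrow> smooth_on U (\<lambda>x. fst (f x))"
  by (rule smooth_on_linear) (auto simp: linear_fst)

lemma smooth_on_snd: "open U \<Longrightarrow> smooth_on U f \<Longrightarrow> smooth_on U (\<lambda>x. snd (f x))"
  by (rule smooth_on_linear) (auto simp: linear_snd)

lemma smooth_on_vec_nth:
  fixes f :: "'a::euclidean_space \<Rightarrow> 'b::euclidean_space^'n::finite"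
  shows "open U \<Longrightarrow> smooth_on U f \<Longrightarrow> smooth_on U (\<lambda>x. f x $ i)"
  by (rule smooth_on_linear) (auto simp: linear_iff)

lemmas smooth_on_intros = smooth_on_const smooth_on_ident smooth_on_add smooth_on_minus
  smooth_on_diff smooth_on_mult smooth_on_power2 smooth_on_divide smooth_on_scaleR smooth_on_inner
  smooth_on_Pair smooth_on_fst smooth_on_snd smooth_on_vec_nth

lemma smooth_on_imp_continuous_on: "smooth_on U f \<Longrightarrow> continuous_on U f"
  unfolding smooth_on_def by (metis Ck_on.simps(1))

section \<open>Smooth maps on arbitrary subsets\<close>

lemma smooth_mapI:
  "open U \<Longrightarrow> M \<subseteq> U \<Longrightarrow> smooth_on U g \<Longrightarrow> (\<And>x. x \<in> M \<Longrightarrow> g x = f x) \<Longrightarrow> smooth_map M f"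
  unfolding smooth_map_def by blast

lemma smooth_map_subset:
  assumes "smooth_map M f" "N \<subseteq> M"
  shows "smooth_map N f"
  unfolding smooth_map_def
proof
  fix x assume "x \<in> N"
  then obtain U g where "open U" "x \<in> U" "smooth_on U g" "\<forall>y\<in>M \<inter> U. g y = f y"
    using assms unfolding smooth_map_def by (meson subsetD)
  then show "\<exists>U g. open U \<and> x \<in> U \<and> smooth_on U g \<and> (\<forall>y\<in>N \<inter> U. g y = f y)"
    using assms(2) by (intro exI[of _ U] exI[of _ g]) auto
qed

lemma smooth_map_cong:
  assumes "smooth_map M f" "\<And>x. x \<in> M \<Longrightarrow> f x = g x"
  shows "smooth_map M g"
  unfolding smooth_map_def
proof
  fix x assume "x \<in> M"
  then obtain U g' where "open U" "x \<in> U" "smooth_on U g'" "\<forall>y\<in>M \<inter> U. g' y = f y"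
    using assms(1) unfolding smooth_map_def by metis
  then show "\<exists>U g'. open U \<and> x \<in> U \<and> smooth_on U g' \<and> (\<forall>y\<in>M \<inter> U. g' y = g y)"
    using assms(2) by (intro exI[of _ U] exI[of _ g']) auto
qed

lemma smooth_map_compose:
  assumes f: "smooth_map N f" and g: "smooth_map M g" and "g ` M \<subseteq> N"
  shows "smooth_map M (\<lambda>x. f (g x))"
  unfolding smooth_map_def
proof
  fix x assume "x \<in> M"
  obtain U g' where U: "open U" "x \<in> U" "smooth_on U g'" "\<forall>y\<in>M \<inter> U. g' y = g y"
    using g \<open>x \<in> M\<close> unfolding smooth_map_def by metis
  have "g x \<in> N"
    using \<open>x \<in> M\<close> assms(3) by blast
  then obtain T f' where T: "open T" "g x \<in> T" "smooth_on T f'" "\<forall>y\<in>N \<inter> T. f' y = f y"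
    using f unfolding smooth_map_def by metis
  \<comment> \<open>The extension \<open>g'\<close> can leave \<open>T\<close> away from
    \<open>M\<close>, so its domain is cut down to the preimage of \<open>T\<close>.\<close>
  let ?U = "U \<inter> g' -` T"
  have o: "open ?U"
    using U T smooth_on_imp_continuous_on continuous_on_open_vimage[of U g']
    by (metis Int_commute)
  have "smooth_on ?U (\<lambda>x. f' (g' x))"
    using smooth_on_compose[OF o T(1) T(3) smooth_on_subset[OF U(3)]] by auto
  moreover have "f' (g' y) = f (g y)" if "y \<in> M \<inter> ?U" for y
    using that U T assms(3) by (auto simp: image_subset_iff)
  ultimately show "\<exists>U h. open U \<and> x \<in> U \<and> smooth_on U h \<and> (\<forall>y\<in>M \<inter> U. h y = f (g y))"
    using o U T \<open>x \<in> M\<close> by (intro exI[of _ ?U] exI[of _ "\<lambda>x. f' (g' x)"]) auto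
qed

lemma smooth_map_locally:
  assumes "\<And>x. x \<in> M \<Longrightarrow> \<exists>U. open U \<and> x \<in> U \<and> smooth_map (M \<inter> U) f"
  shows "smooth_map M f"
  unfolding smooth_map_def
proof
  fix x assume "x \<in> M"
  then obtain U where U: "open U" "x \<in> U" "smooth_map (M \<inter> U) f"
    using assms by blast
  then obtain V g where V: "open V" "x \<in> V" "smooth_on V g" "\<forall>y\<in>M \<inter> U \<inter> V. g y = f y"
    using \<open>x \<in> M\<close> unfolding smooth_map_def by (metis IntI)
  then show "\<exists>U g. open U \<and> x \<in> U \<and> smooth_on U g \<and> (\<forall>y\<in>M \<inter> U. g y = f y)"
    using U by (intro exI[of _ "U \<inter> V"] exI[of _ g]) (auto intro: smooth_on_subset)
qed

lemma smooth_map_linear: "linear h \<Longrightarrow> smooth_map M h"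
  using smooth_on_linear[of UNIV h "\<lambda>x. x"] smooth_on_ident[of UNIV]
  by (intro smooth_mapI[of UNIV _ h]) auto

lemma smooth_map_linear_compose: "linear h \<Longrightarrow> smooth_map M f \<Longrightarrow> smooth_map M (\<lambda>x. h (f x))"
  by (rule smooth_map_compose[OF smooth_map_linear[of h UNIV]]) auto

lemma smooth_map_add:
  assumes "smooth_map M f" "smooth_map M g"
  shows "smooth_map M (\<lambda>x. f x + g x)"
  unfolding smooth_map_def
proof
  fix x assume "x \<in> M"
  obtain U f' where U: "open U" "x \<in> U" "smooth_on U f'" "\<forall>y\<in>M \<inter> U. f' y = f y"
    using assms(1) \<open>x \<in> M\<close> unfolding smooth_map_def by metis
  obtain V g' where V: "open V" "x \<in> V" "smooth_on V g'" "\<forall>y\<in>M \<inter> V. g' y = g y"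
    using assms(2) \<open>x \<in> M\<close> unfolding smooth_map_def by metis
  show "\<exists>U h. open U \<and> x \<in> U \<and> smooth_on U h \<and> (\<forall>y\<in>M \<inter> U. h y = f y + g y)"
    using U V by (intro exI[of _ "U \<inter> V"] exI[of _ "\<lambda>x. f' x + g' x"])
      (auto intro!: smooth_on_add intro: smooth_on_subset)
qed

subsection \<open>Tangent vectors\<close>

lemma linear_imp_has_derivative_at:
  fixes f :: "'a::euclidean_space \<Rightarrow> 'b::real_normed_vector"
  shows "linear f \<Longrightarrow> (f has_derivative f) (at x)"
  by (simp add: bounded_linear_imp_has_derivative linear_conv_bounded_linear)

lemma curve_in_isCont: "curve_in M x v \<gamma> \<Longrightarrow> isCont \<gamma> 0"
  unfolding curve_in_def using has_vector_derivative_continuous by blast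

lemma curve_in_chain:
  assumes "curve_in M x v \<gamma>" "(g has_derivative g') (at x)"
  shows "((g \<circ> \<gamma>) has_vector_derivative g' v) (at 0)"
proof -
  have "(\<gamma> has_vector_derivative v) (at 0)" "\<gamma> 0 = x"
    using assms(1) by (auto simp: curve_in_def)
  then show ?thesis
    using vector_diff_chain_at assms(2)
    by (metis vector_derivative_diff_chain_within has_derivative_at_withinI UNIV_I image_subset_iff)
qed

text \<open>Every curve in \<open>M\<close> with velocity \<open>v\<close> stays in \<open>U\<close>
  for small times, so the ambient derivative of the local extension \<open>g\<close> gives one and
  the same value along all of them. This settles existence and uniqueness in the description of
  \<open>tangent_map\<close>.\<close>

lemma tangent_map_eq:
  assumes "v \<in> tangent_space M x" "(g has_derivative g') (at x)"
    and "open U" "x \<in> U" "\<And>y. y \<in> M \<inter> U \<Longrightarrow> f y = g y"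
  shows "tangent_map M f x v = g' v"
proof -
  have *: "((f \<circ> \<gamma>) has_vector_derivative g' v) (at 0)" if c: "curve_in M x v \<gamma>" for \<gamma>
  proof -
    have "\<gamma> 0 \<in> U"
      using c assms(4) by (simp add: curve_in_def)
    then obtain T where T: "open T" "0 \<in> T" "\<forall>t\<in>T. \<gamma> t \<in> U"
      using curve_in_isCont[OF c] assms(3) unfolding continuous_at_open by blast
    moreover have "\<gamma> t \<in> M" for t
      using c by (auto simp: curve_in_def)
    ultimately have "(g \<circ> \<gamma>) t = (f \<circ> \<gamma>) t" if "t \<in> T" for t
      using assms(5) that by auto
    then show ?thesis
      using has_vector_derivative_transform_within_open[OF curve_in_chain[OF c assms(2)] T(1,2)]
      by blast
  qed
  obtain \<gamma> where "curve_in M x v \<gamma>"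
    using assms(1) by (auto simp: tangent_space_def)
  then show ?thesis
    unfolding tangent_map_def
    using * by (intro the_equality) (auto dest: vector_derivative_unique_at)
qed

lemma tangent_map_linear:
  assumes "v \<in> tangent_space M x" "linear f"
  shows "tangent_map M f x v = f v"
  using tangent_map_eq[OF assms(1) linear_imp_has_derivative_at[OF assms(2)], of UNIV f] by simp

lemma tangent_spaceI:
  assumes "range \<gamma> \<subseteq> M" "\<gamma> 0 = x" "(\<gamma> has_vector_derivative v) (at 0)"
  shows "v \<in> tangent_space M x"
  using assms by (auto simp: tangent_space_def curve_in_def)

lemma tangent_space_image:
  assumes "v \<in> tangent_space M x" "(g has_derivative g') (at x)" "g ` M \<subseteq> N"
  shows "g' v \<in> tangent_space N (g x)"
proof -
  obtain \<gamma> where c: "curve_in M x v \<gamma>"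
    using assms(1) by (auto simp: tangent_space_def)
  then show ?thesis
    using curve_in_chain[OF c assms(2)] assms(3)
    by (intro tangent_spaceI[of "g \<circ> \<gamma>"]) (auto simp: curve_in_def)
qed

text \<open>A function constant on \<open>M\<close> is constant along curves in \<open>M\<close>.
  Applied to the defining equations of a set, this bounds its tangent space from above.\<close>

lemma tangent_space_level:
  assumes "v \<in> tangent_space M x" "(g has_derivative g') (at x)" "\<And>y. y \<in> M \<Longrightarrow> g y = c"
  shows "g' v = 0"
proof -
  obtain \<gamma> where c: "curve_in M x v \<gamma>"
    using assms(1) by (auto simp: tangent_space_def)
  have "g \<circ> \<gamma> = (\<lambda>_. c)"
    using c assms(3) by (auto simp: curve_in_def fun_eq_iff image_subset_iff)
  then show ?thesis
    using curve_in_chain[OF c assms(2)] vector_derivative_unique_at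
    by (metis has_vector_derivative_const)
qed

text \<open>Charts are multiplied by the identity. The phase space and the reduced space are both of
  this form, over the rotation group and over a sphere.\<close>

lemma embedded_submanifold_Times_UNIV:
  assumes "embedded_submanifold d (M :: 'a::euclidean_space set)"
  shows "embedded_submanifold (d + DIM('b)) (M \<times> (UNIV :: 'b::euclidean_space set))"
  unfolding embedded_submanifold_def
proof
  fix x :: "'a \<times> 'b" assume "x \<in> M \<times> UNIV"
  then have "fst x \<in> M" by auto
  then obtain U and S :: "'a set" and N \<phi> \<psi> where U: "open U" "fst x \<in> U" "subspace S" "dim S = d"
      "openin (top_of_set S) N" "smooth_map N \<phi>" "smooth_map (M \<inter> U) \<psi>"
      "\<phi> ` N = M \<inter> U" "\<psi> ` (M \<inter> U) = N"
      "\<forall>y\<in>N. \<psi> (\<phi> y) = y" "\<forall>z\<in>M \<inter> U. \<phi> (\<psi> z) = z"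
    using assms unfolding embedded_submanifold_def by metis
  have sm: "smooth_map (K \<times> (UNIV :: 'b set)) (\<lambda>x. (f (fst x), snd x))"
    if "smooth_map K f" for K and f :: "'a \<Rightarrow> 'a"
  proof -
    have "smooth_map (K \<times> (UNIV :: 'b set)) (\<lambda>x. f (fst x))"
      by (rule smooth_map_compose[OF that]) (auto intro: smooth_map_linear linear_fst)
    from smooth_map_linear_compose[OF _ this, of "\<lambda>y. (y, 0)"]
    have "smooth_map (K \<times> (UNIV :: 'b set)) (\<lambda>x. (f (fst x), 0) + (0, snd x))"
      by (intro smooth_map_add smooth_map_linear[of "\<lambda>x. (0, snd x)"]) (auto simp: linear_iff)
    then show ?thesis by simp
  qed
  have im: "(\<lambda>x. (f (fst x), snd x)) ` (K \<times> (UNIV :: 'b set)) = (f ` K) \<times> UNIV"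
    for f :: "'a \<Rightarrow> 'a" and K
    by force
  let ?\<phi> = "\<lambda>x :: 'a \<times> 'b. (\<phi> (fst x), snd x)" and ?\<psi> = "\<lambda>x :: 'a \<times> 'b. (\<psi> (fst x), snd x)"
  have eq: "(M \<times> (UNIV :: 'b set)) \<inter> (U \<times> UNIV) = (M \<inter> U) \<times> UNIV"
    by auto
  show "\<exists>U (S :: ('a \<times> 'b) set) N \<phi> \<psi>. open U \<and> x \<in> U \<and> subspace S \<and> dim S = d + DIM('b) \<and>
        openin (top_of_set S) N \<and> smooth_map N \<phi> \<and> smooth_map (M \<times> UNIV \<inter> U) \<psi> \<and>
        \<phi> ` N = M \<times> UNIV \<inter> U \<and> \<psi> ` (M \<times> UNIV \<inter> U) = N \<and>
        (\<forall>y\<in>N. \<psi> (\<phi> y) = y) \<and> (\<forall>z\<in>M \<times> UNIV \<inter> U. \<phi> (\<psi> z) = z)"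
  proof (rule exI[of _ "U \<times> UNIV"], rule exI[of _ "S \<times> UNIV"], rule exI[of _ "N \<times> UNIV"],
      rule exI[of _ ?\<phi>], rule exI[of _ ?\<psi>], unfold eq im, intro conjI)
    show "open (U \<times> (UNIV :: 'b set))" "x \<in> U \<times> UNIV" "subspace (S \<times> (UNIV :: 'b set))"
      using U by (auto simp: open_Times mem_Times_iff intro: subspace_Times)
    show "dim (S \<times> (UNIV :: 'b set)) = d + DIM('b)"
      using U(3,4) by (simp add: dim_Times)
    show "openin (top_of_set (S \<times> (UNIV :: 'b set))) (N \<times> UNIV)"
      using U(5) by (simp add: openin_Times)
    show "smooth_map (N \<times> UNIV) ?\<phi>" "smooth_map ((M \<inter> U) \<times> UNIV) ?\<psi>"
      using sm U(6,7) by auto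
  qed (use U in auto)
qed

subsection \<open>Rotations and the Cayley transform\<close>

declare transpose_matrix_vector [simp del]

lemma hat_entries:
  "hat \<xi> $ 1 $ 1 = 0" "hat \<xi> $ 1 $ 2 = - \<xi> $ 3" "hat \<xi> $ 1 $ 3 = \<xi> $ 2"
  "hat \<xi> $ 2 $ 1 = \<xi> $ 3" "hat \<xi> $ 2 $ 2 = 0" "hat \<xi> $ 2 $ 3 = - \<xi> $ 1"
  "hat \<xi> $ 3 $ 1 = - \<xi> $ 2" "hat \<xi> $ 3 $ 2 = \<xi> $ 1" "hat \<xi> $ 3 $ 3 = 0"
  by (simp_all add: hat_def matrix_def cross_components axis_def)

lemma hat_mult_vector: "hat \<xi> *v x = cross3 \<xi> x"
  using bilinear_cross by (simp add: hat_def matrix_works bilinear_def)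

lemma linear_hat: "linear hat"
  by (auto simp: linear_iff vec_eq_iff forall_3 hat_entries)

lemma vee_entries:
  "vee M $ 1 = (M$3$2 - M$2$3) / 2" "vee M $ 2 = (M$1$3 - M$3$1) / 2"
  "vee M $ 3 = (M$2$1 - M$1$2) / 2"
  by (simp_all add: vee_def)

lemma linear_vee: "linear vee"
  by (auto simp: linear_iff vec_eq_iff forall_3 vee_entries field_simps)

lemma vee_hat [simp]: "vee (hat \<xi>) = \<xi>"
  by (simp add: vec_eq_iff forall_3 vee_entries hat_entries)

lemma hat_vee: "hat (vee M) = (1/2) *\<^sub>R (M - transpose M)"
  by (simp add: vec_eq_iff forall_3 vee_entries hat_entries transpose_def field_simps)

lemma hat_vee_skew: "transpose M = - M \<Longrightarrow> hat (vee M) = M"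
  by (simp add: hat_vee scaleR_2[symmetric])

lemma transpose_hat: "transpose (hat \<xi>) = - hat \<xi>"
  by (simp add: vec_eq_iff forall_3 hat_entries transpose_def)

text \<open>The product is \<open>- (hat \<xi> ** hat \<eta>)\<close>. Its skew part is minus half
  the commutator of the two factors, and that commutator is \<open>hat\<close> of the cross
  product.\<close>

lemma vee_transpose_hat_mult:
  "vee (transpose (hat \<xi>) ** hat \<eta>) = - (1/2) *\<^sub>R cross3 \<xi> \<eta>"
  by (simp add: vec_eq_iff forall_3 vee_entries hat_entries transpose_def cross_components
      matrix_matrix_mult_def sum_3 field_simps)

section \<open>Rotation matrices and coadjoint orbits\<close>

lemma SO3_iff: "A \<in> SO3 \<longleftrightarrow> transpose A ** A = mat 1 \<and> det A = 1"
  by (simp add: rotation_matrix_def orthogonal_matrix)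

lemma SO3_mult_transpose:
  assumes "A \<in> SO3"
  shows "A ** transpose A = mat 1" "transpose A ** A = mat 1"
  using assms by (auto simp: rotation_matrix_def orthogonal_matrix_def)

text \<open>These are the rewrite rules that invert a rotation. They match
  \<open>transpose A *v x\<close>, which is why \<open>transpose_matrix_vector\<close> was taken out
  of the simpset.\<close>

lemma SO3_cancel:
  assumes "A \<in> SO3"
  shows "transpose A ** (A ** B) = B" "A ** (transpose A ** B) = B"
    "transpose A *v (A *v x) = x" "A *v (transpose A *v x) = x"
  using SO3_mult_transpose[OF assms]
  by (simp_all add: matrix_mul_assoc matrix_vector_mul_assoc)

lemma SO3_mult: "A \<in> SO3 \<Longrightarrow> B \<in> SO3 \<Longrightarrow> A ** B \<in> SO3"
  by (simp add: rotation_matrix_def orthogonal_matrix_mul det_mul)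

lemma SO3_transpose: "A \<in> SO3 \<Longrightarrow> transpose A \<in> SO3"
  by (simp add: rotation_matrix_def det_transpose)

lemma SO3_one: "mat 1 \<in> SO3"
  by (simp add: rotation_matrix_def orthogonal_matrix_id)

lemma SO3_inner: "A \<in> SO3 \<Longrightarrow> (A *v x) \<bullet> (A *v y) = x \<bullet> y"
  using SO3_cancel(3)[of A y] by (metis dot_lmul_matrix inner_commute matrix_vector_mul_assoc
      transpose_matrix_vector SO3_cancel(3))

lemma SO3_inner_transpose: "A \<in> SO3 \<Longrightarrow> (A *v x) \<bullet> y = x \<bullet> (transpose A *v y)"
  by (metis SO3_cancel(4) SO3_inner)

text \<open>Rotations preserve the cross product. This identity makes \<open>Ad B\<close> act as
  \<open>B\<close> itself and converts spatial velocities into body velocities.\<close>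

lemma SO3_hat_conj:
  assumes "A \<in> SO3"
  shows "A ** hat \<xi> = hat (A *v \<xi>) ** A"
proof -
  have "(A ** hat \<xi>) *v x = (hat (A *v \<xi>) ** A) *v x" for x
    using assms cross_rotation_matrix[of A \<xi> x]
    by (simp add: matrix_vector_mul_assoc[symmetric] hat_mult_vector)
  then show ?thesis
    by (simp add: matrix_eq)
qed

lemma Ad_SO3: "B \<in> SO3 \<Longrightarrow> Ad B \<xi> = B *v \<xi>"
  by (simp add: Ad_def SO3_hat_conj matrix_mul_assoc[symmetric] SO3_mult_transpose(1))

lemma coAd_SO3:
  assumes "B \<in> SO3"
  shows "coAd B \<xi> = B *v \<xi>"
proof -
  have "Ad (transpose B) = (\<lambda>\<eta>. transpose B *v \<eta>)"
    using Ad_SO3[OF SO3_transpose[OF assms]] by blast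
  then show ?thesis
    by (simp add: coAd_def adjoint_matrix)
qed

lemma SO3_transitive:
  fixes P Q :: "real^3"
  assumes "norm P = norm Q"
  obtains A where "A \<in> SO3" "A *v P = Q"
proof -
  obtain f where f: "orthogonal_transformation f" "det (matrix f) = 1" "f P = Q"
    using rotation_exists[of P Q] assms by auto
  show ?thesis
  proof
    show "matrix f \<in> SO3" "matrix f *v P = Q"
      using f by (auto simp: rotation_matrix_def orthogonal_transformation_matrix)
  qed
qed

text \<open>Rotations preserve the norm and act transitively on vectors of equal norm. For \<mu> = 0
  both sides are a single point.\<close>

lemma coadjoint_orbit_eq_sphere: "coadjoint_orbit \<mu> = sphere 0 (norm \<mu>)"
proof
  show "coadjoint_orbit \<mu> \<subseteq> sphere 0 (norm \<mu>)"
    using SO3_inner by (auto simp: coadjoint_orbit_def coAd_SO3 norm_eq_sqrt_inner)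
  show "sphere 0 (norm \<mu>) \<subseteq> coadjoint_orbit \<mu>"
  proof
    fix P :: "real^3" assume "P \<in> sphere 0 (norm \<mu>)"
    then obtain A where "A \<in> SO3" "A *v \<mu> = P"
      using SO3_transitive[of \<mu> P] by auto
    then show "P \<in> coadjoint_orbit \<mu>"
      using coAd_SO3 by (force simp: coadjoint_orbit_def)
  qed
qed

text \<open>Rodrigues form of \<open>(I + hat v) (I - hat v)\<^sup>-\<^sup>1\<close>, the rotation about \<open>v\<close> by the angle
  \<open>2 arctan |v|\<close>.\<close>

definition cay :: "real^3 \<Rightarrow> real^3^3" where
  "cay v = (1 / (1 + v \<bullet> v)) *\<^sub>R
     ((1 - v \<bullet> v) *\<^sub>R mat 1 + 2 *\<^sub>R (\<chi> i j. v$i * v$j) + 2 *\<^sub>R hat v)"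

text \<open>With all entries over one denominator, the group properties of \<open>cay\<close> become
  polynomial identities in the coordinates of \<open>v\<close>.\<close>

lemma cay_entries:
  fixes v :: "real^3"
  defines "n \<equiv> 1 + (v$1)\<^sup>2 + (v$2)\<^sup>2 + (v$3)\<^sup>2"
  shows "cay v $ 1 $ 1 = (1 + (v$1)\<^sup>2 - (v$2)\<^sup>2 - (v$3)\<^sup>2) / n"
    "cay v $ 2 $ 2 = (1 - (v$1)\<^sup>2 + (v$2)\<^sup>2 - (v$3)\<^sup>2) / n"
    "cay v $ 3 $ 3 = (1 - (v$1)\<^sup>2 - (v$2)\<^sup>2 + (v$3)\<^sup>2) / n"
    "cay v $ 1 $ 2 = 2 * (v$1 * v$2 - v$3) / n"
    "cay v $ 2 $ 1 = 2 * (v$1 * v$2 + v$3) / n"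
    "cay v $ 1 $ 3 = 2 * (v$1 * v$3 + v$2) / n"
    "cay v $ 3 $ 1 = 2 * (v$1 * v$3 - v$2) / n"
    "cay v $ 2 $ 3 = 2 * (v$2 * v$3 - v$1) / n"
    "cay v $ 3 $ 2 = 2 * (v$2 * v$3 + v$1) / n"
proof -
  have n: "1 + v \<bullet> v = n"
    by (simp add: n_def inner_vec_def sum_3 power2_eq_square)
  show "cay v $ 1 $ 1 = (1 + (v$1)\<^sup>2 - (v$2)\<^sup>2 - (v$3)\<^sup>2) / n"
    "cay v $ 2 $ 2 = (1 - (v$1)\<^sup>2 + (v$2)\<^sup>2 - (v$3)\<^sup>2) / n"
    "cay v $ 3 $ 3 = (1 - (v$1)\<^sup>2 - (v$2)\<^sup>2 + (v$3)\<^sup>2) / n"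
    "cay v $ 1 $ 2 = 2 * (v$1 * v$2 - v$3) / n"
    "cay v $ 2 $ 1 = 2 * (v$1 * v$2 + v$3) / n"
    "cay v $ 1 $ 3 = 2 * (v$1 * v$3 + v$2) / n"
    "cay v $ 3 $ 1 = 2 * (v$1 * v$3 - v$2) / n"
    "cay v $ 2 $ 3 = 2 * (v$2 * v$3 - v$1) / n"
    "cay v $ 3 $ 2 = 2 * (v$2 * v$3 + v$1) / n"
    unfolding cay_def n
    by (simp_all add: hat_entries mat_def inner_vec_def sum_3 power2_eq_square mult.commute
        right_diff_distrib distrib_left add_divide_distrib diff_divide_distrib)
qed

lemma one_plus_inner_pos: "1 + v \<bullet> (v :: 'a::real_inner) > 0"
  by (simp add: add_pos_nonneg)

lemma cay_SO3: "cay v \<in> SO3"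
proof -
  define a b c n where "a = v$1" and "b = v$2" and "c = v$3" and "n = 1 + a\<^sup>2 + b\<^sup>2 + c\<^sup>2"
  have n: "n \<noteq> 0"
    by (smt (verit) n_def zero_le_power2)
  note e = cay_entries[of v, folded a_def b_def c_def, folded n_def]
  \<comment> \<open>The denominator \<open>n\<close> stays opaque while fractions are cleared and is
    expanded only afterwards, which leaves a polynomial identity.\<close>
  have "transpose (cay v) ** cay v = mat 1"
    using n
    by (simp add: vec_eq_iff forall_3 matrix_matrix_mult_def sum_3 transpose_def mat_def e,
        simp add: divide_simps, simp add: n_def, algebra)
  moreover have "det (cay v) = 1"
    using n by (simp add: det_3 e, simp add: divide_simps, simp add: n_def, algebra)
  ultimately show ?thesis unfolding SO3_iff by simp
qed

lemma cay_0 [simp]: "cay 0 = mat 1"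
  by (simp add: cay_def vec_eq_iff hat_entries forall_3)

text \<open>For a rotation by the angle \<theta> the axial part has length
  \<open>sin \<theta>\<close> and \<open>1 + trace R\<close> is \<open>2 + 2 * cos \<theta>\<close>,
  so the result has length \<open>tan (\<theta> / 2)\<close>. The formula breaks down exactly at
  half turns, where the denominator vanishes.\<close>

definition uncay :: "real^3^3 \<Rightarrow> real^3" where
  "uncay R = (2 / (1 + trace R)) *\<^sub>R vee R"

lemma trace_cay: "1 + trace (cay v) = 4 / (1 + v \<bullet> v)"
  and vee_cay: "vee (cay v) = (2 / (1 + v \<bullet> v)) *\<^sub>R v"
proof -
  define n where "n = 1 + (v$1)\<^sup>2 + (v$2)\<^sup>2 + (v$3)\<^sup>2"
  have n: "1 + v \<bullet> v = n"
    by (simp add: n_def inner_vec_def sum_3 power2_eq_square)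
  then have n0: "n \<noteq> 0"
    using one_plus_inner_pos[of v] by simp
  note e = cay_entries[of v, folded n_def]
  have "trace (cay v) = (3 - (v$1)\<^sup>2 - (v$2)\<^sup>2 - (v$3)\<^sup>2) / n"
    by (simp add: trace_def sum_3 e add_divide_distrib[symmetric])
  also have "\<dots> = (4 - n) / n"
    by (simp add: n_def)
  finally show "1 + trace (cay v) = 4 / (1 + v \<bullet> v)"
    unfolding n using n0 by (simp add: field_simps)
  show "vee (cay v) = (2 / (1 + v \<bullet> v)) *\<^sub>R v"
    unfolding n by (simp add: vec_eq_iff forall_3 vee_entries e diff_divide_distrib[symmetric])
qed

lemma uncay_cay [simp]: "uncay (cay v) = v"
  using one_plus_inner_pos[of v] by (simp add: uncay_def trace_cay vee_cay)

text \<open>In terms of the unit quaternion \<open>(q0, q)\<close> of \<open>R\<close>, \<open>t = 4 q0\<^sup>2\<close> and \<open>w = 4 q0 q\<close>.\<close>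

lemma SO3_entry_relations:
  assumes "R \<in> SO3"
  defines "w \<equiv> 2 *\<^sub>R vee R" and "t \<equiv> 1 + trace R"
  shows "w$1 * w$1 = t * (1 + R$1$1 - R$2$2 - R$3$3)"
    and "w$2 * w$2 = t * (1 - R$1$1 + R$2$2 - R$3$3)"
    and "w$3 * w$3 = t * (1 - R$1$1 - R$2$2 + R$3$3)"
    and "w$1 * w$2 = t * (R$1$2 + R$2$1)"
    and "w$1 * w$3 = t * (R$1$3 + R$3$1)"
    and "w$2 * w$3 = t * (R$2$3 + R$3$2)"
proof -
  have rows: "(R ** transpose R) $ i $ j = (if i = j then 1 else 0)"
    and cols: "(transpose R ** R) $ i $ j = (if i = j then 1 else 0)" for i j
    using SO3_mult_transpose[OF assms(1)] by (simp_all add: mat_def)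
  note row = rows[unfolded matrix_matrix_mult_def transpose_def, simplified, unfolded sum_3]
  note col = cols[unfolded matrix_matrix_mult_def transpose_def, simplified, unfolded sum_3]
  \<comment> \<open>The cross product of two columns is the third: a rotation equals its cofactor
    matrix. Here determinant 1 enters, beyond orthogonality.\<close>
  have cof: "cross3 (R *v axis i 1) (R *v axis j 1) = R *v cross3 (axis i 1) (axis j 1)" for i j
    using cross_rotation_matrix[of R] assms(1) by simp
  have cof: "cross3 (column 1 R) (column 2 R) = column 3 R"
    "cross3 (column 2 R) (column 3 R) = column 1 R"
    "cross3 (column 3 R) (column 1 R) = column 2 R"
    using cof[of 1 2] cof[of 2 3] cof[of 3 1] by (simp_all add: cross_basis matrix_vector_mult_basis)
  have cof: "R$2$2 * R$3$3 - R$2$3 * R$3$2 = R$1$1" "R$3$3 * R$1$1 - R$3$1 * R$1$3 = R$2$2"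
    "R$1$1 * R$2$2 - R$1$2 * R$2$1 = R$3$3"
    "R$2$3 * R$3$1 - R$2$1 * R$3$3 = R$1$2" "R$3$2 * R$1$3 - R$3$3 * R$1$2 = R$2$1"
    "R$2$1 * R$3$2 - R$2$2 * R$3$1 = R$1$3" "R$1$2 * R$2$3 - R$1$3 * R$2$2 = R$3$1"
    "R$3$1 * R$1$2 - R$3$2 * R$1$1 = R$2$3" "R$1$3 * R$2$1 - R$1$1 * R$2$3 = R$3$2"
    using cof[unfolded vec_eq_iff forall_3 cross_components column_def, simplified] by simp_all
  have t: "t = 1 + R$1$1 + R$2$2 + R$3$3"
    by (simp add: t_def trace_def sum_3)
  have w: "w$1 = R$3$2 - R$2$3" "w$2 = R$1$3 - R$3$1" "w$3 = R$2$1 - R$1$2"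
    by (simp_all add: w_def vee_entries)
  \<comment> \<open>The cofactor relation eliminates the product of the last two diagonal entries.
    What remains is that \<open>1 + R$1$1 * R$1$1\<close> is the sum of squares of the lower right
    block, which follows from the norms of columns 2 and 3 and of row 1. The other two squares are
    analogous.\<close>
  show "w$1 * w$1 = t * (1 + R$1$1 - R$2$2 - R$3$3)"
    using row[of 1 1] col[of 2 2] col[of 3 3] cof(1) unfolding t w if_True simp_thms
    by algebra
  show "w$2 * w$2 = t * (1 - R$1$1 + R$2$2 - R$3$3)"
    using row[of 2 2] col[of 1 1] col[of 3 3] cof(2) unfolding t w if_True simp_thms
    by algebra
  show "w$3 * w$3 = t * (1 - R$1$1 - R$2$2 + R$3$3)"
    using row[of 3 3] col[of 1 1] col[of 2 2] cof(3) unfolding t w if_True simp_thms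
    by algebra
  show "w$1 * w$2 = t * (R$1$2 + R$2$1)"
    using row[of 1 2, simplified] col[of 1 2, simplified] cof(4,5) unfolding t w by algebra
  show "w$1 * w$3 = t * (R$1$3 + R$3$1)"
    using row[of 1 3, simplified] col[of 1 3, simplified] cof(6,7) unfolding t w by algebra
  show "w$2 * w$3 = t * (R$2$3 + R$3$2)"
    using row[of 2 3, simplified] col[of 2 3, simplified] cof(8,9) unfolding t w by algebra
qed

text \<open>By the entry relations every product of two coordinates of \<open>v\<close> is linear in
  the entries of \<open>R\<close>, divided by \<open>t\<close>. The numerators in
  \<open>cay v\<close> become \<open>4 * R$i$j / t\<close> and the denominator becomes
  \<open>4 / t\<close>.\<close>

lemma cay_uncay:
  assumes "R \<in> SO3" "1 + trace R \<noteq> 0"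
  shows "cay (uncay R) = R"
proof -
  define t where "t = 1 + trace R"
  define v where "v = uncay R"
  have t0: "t \<noteq> 0" and t: "t = 1 + R$1$1 + R$2$2 + R$3$3"
    using assms(2) by (simp_all add: t_def trace_def sum_3)
  have v: "v$1 = (R$3$2 - R$2$3) / t" "v$2 = (R$1$3 - R$3$1) / t" "v$3 = (R$2$1 - R$1$2) / t"
    by (simp_all add: v_def uncay_def vee_entries t_def[symmetric] diff_divide_distrib)
  have vw: "v $ i * v $ j = ((2 *\<^sub>R vee R) $ i * (2 *\<^sub>R vee R) $ j) / (t * t)" for i j
    by (simp add: v_def uncay_def t_def)
  have p: "(v$1)\<^sup>2 = (1 + R$1$1 - R$2$2 - R$3$3) / t" "(v$2)\<^sup>2 = (1 - R$1$1 + R$2$2 - R$3$3) / t"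
    "(v$3)\<^sup>2 = (1 - R$1$1 - R$2$2 + R$3$3) / t" "v$1 * v$2 = (R$1$2 + R$2$1) / t"
    "v$1 * v$3 = (R$1$3 + R$3$1) / t" "v$2 * v$3 = (R$2$3 + R$3$2) / t"
    unfolding power2_eq_square vw SO3_entry_relations[OF assms(1)] t_def[symmetric]
    using t0 by simp_all
  have d: "1 + (v$1)\<^sup>2 + (v$2)\<^sup>2 + (v$3)\<^sup>2 = 4 / t"
    "1 + (v$1)\<^sup>2 - (v$2)\<^sup>2 - (v$3)\<^sup>2 = 4 * R$1$1 / t"
    "1 - (v$1)\<^sup>2 + (v$2)\<^sup>2 - (v$3)\<^sup>2 = 4 * R$2$2 / t"
    "1 - (v$1)\<^sup>2 - (v$2)\<^sup>2 + (v$3)\<^sup>2 = 4 * R$3$3 / t"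
    unfolding p using t0 by (simp_all add: divide_simps) (use t in linarith)+
  note e = cay_entries[of v, unfolded d, unfolded p, unfolded v]
  have "cay v = R"
    unfolding vec_eq_iff forall_3 e using t0 by (simp add: field_simps)
  then show ?thesis by (simp add: v_def)
qed

text \<open>To first order \<open>cay w\<close> is \<open>mat 1 + 2 *\<^sub>R hat w\<close>, hence
  the halved parameter. These curves take the place of one-parameter subgroups.\<close>

lemma has_vector_derivative_cay:
  "((\<lambda>s. cay ((s / 2) *\<^sub>R v)) has_vector_derivative hat v) (at 0)"
proof -
  define \<eta> where "\<eta> = v /\<^sub>R 2"
  define c where "c = \<eta> \<bullet> \<eta>"
  have "cay (s *\<^sub>R \<eta>) = (1 / (1 + s * s * c)) *\<^sub>R
      ((1 - s * s * c) *\<^sub>R mat 1 + (2 * s * s) *\<^sub>R (\<chi> i j. \<eta>$i * \<eta>$j) + (2 * s) *\<^sub>R hat \<eta>)" for s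
    unfolding cay_def c_def linear_scale[OF linear_hat]
    by (simp add: vec_eq_iff algebra_simps)
  moreover have "((\<lambda>s. (1 / (1 + s * s * c)) *\<^sub>R
      ((1 - s * s * c) *\<^sub>R mat 1 + (2 * s * s) *\<^sub>R (\<chi> i j. \<eta>$i * \<eta>$j) + (2 * s) *\<^sub>R hat \<eta>))
      has_vector_derivative 2 *\<^sub>R hat \<eta>) (at 0)"
    by (auto intro!: derivative_eq_intros)
  moreover have "2 *\<^sub>R hat \<eta> = hat v"
    by (simp add: \<eta>_def linear_scale[OF linear_hat])
  ultimately show ?thesis by (simp add: \<eta>_def)
qed

section \<open>Smooth matrix operations and charts of the rotation group\<close>

lemma smooth_on_hat: "open U \<Longrightarrow> smooth_on U f \<Longrightarrow> smooth_on U (\<lambda>x. hat (f x))"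
  by (rule smooth_on_linear[OF _ linear_hat])

lemma smooth_on_vee: "open U \<Longrightarrow> smooth_on U f \<Longrightarrow> smooth_on U (\<lambda>x. vee (f x))"
  by (rule smooth_on_linear[OF _ linear_vee])

lemma bilinear_matrix_mult: "bilinear ((**) :: real^'n^'m \<Rightarrow> real^'k^'n \<Rightarrow> real^'k^'m)"
  by (auto simp: bilinear_def linear_iff matrix_add_ldistrib matrix_matrix_mult_def vec_eq_iff
      sum.distrib algebra_simps sum_distrib_left)

lemma bilinear_matrix_vector_mult: "bilinear ((*v) :: real^'n^'m \<Rightarrow> real^'n \<Rightarrow> real^'m)"
  by (auto simp: bilinear_def linear_iff matrix_vector_mult_def vec_eq_iff
      sum.distrib algebra_simps sum_distrib_left)

lemma linear_transpose: "linear (transpose :: real^'n^'m \<Rightarrow> real^'m^'n)"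
  by (auto simp: linear_iff transpose_def vec_eq_iff)

lemma linear_trace: "linear (trace :: real^'n^'n \<Rightarrow> real)"
  by (auto simp: linear_iff trace_def sum.distrib sum_distrib_left)

lemma smooth_on_matrix_mult:
  fixes f :: "'a::euclidean_space \<Rightarrow> real^'n^'m" and g :: "'a \<Rightarrow> real^'k^'n"
  shows "open U \<Longrightarrow> smooth_on U f \<Longrightarrow> smooth_on U g \<Longrightarrow> smooth_on U (\<lambda>x. f x ** g x)"
  by (rule smooth_on_bilinear[OF _ bilinear_matrix_mult])

lemma smooth_on_matrix_vector_mult:
  fixes f :: "'a::euclidean_space \<Rightarrow> real^'n^'m" and g :: "'a \<Rightarrow> real^'n"
  shows "open U \<Longrightarrow> smooth_on U f \<Longrightarrow> smooth_on U g \<Longrightarrow> smooth_on U (\<lambda>x. f x *v g x)"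
  by (rule smooth_on_bilinear[OF _ bilinear_matrix_vector_mult])

lemma smooth_on_cross3:
  "open U \<Longrightarrow> smooth_on U f \<Longrightarrow> smooth_on U g \<Longrightarrow> smooth_on U (\<lambda>x. cross3 (f x) (g x))"
  by (rule smooth_on_bilinear[OF _ bilinear_cross])

lemma smooth_on_transpose:
  fixes f :: "'a::euclidean_space \<Rightarrow> real^'n^'m"
  shows "open U \<Longrightarrow> smooth_on U f \<Longrightarrow> smooth_on U (\<lambda>x. transpose (f x))"
  by (rule smooth_on_linear[OF _ linear_transpose])

lemma smooth_on_trace:
  fixes f :: "'a::euclidean_space \<Rightarrow> real^'n^'n"
  shows "open U \<Longrightarrow> smooth_on U f \<Longrightarrow> smooth_on U (\<lambda>x. trace (f x))"
  by (rule smooth_on_linear[OF _ linear_trace])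

lemma smooth_on_cay:
  assumes "open U" "smooth_on U f"
  shows "smooth_on U (\<lambda>x. cay (f x))"
proof -
  have "bilinear (\<lambda>v w :: real^3. (\<chi> i j. v$i * w$j) :: real^3^3)"
    by (auto simp: bilinear_def linear_iff vec_eq_iff algebra_simps)
  from smooth_on_bilinear[OF assms(1) this assms(2) assms(2)] show ?thesis
    unfolding cay_def using assms one_plus_inner_pos
    by (intro smooth_on_intros smooth_on_hat) (auto dest: less_imp_neq[OF one_plus_inner_pos, symmetric, THEN notE])
qed

lemma smooth_on_uncay:
  assumes "open U" "smooth_on U f" "\<And>x. x \<in> U \<Longrightarrow> 1 + trace (f x) \<noteq> 0"
  shows "smooth_on U (\<lambda>x. uncay (f x))"
  unfolding uncay_def using assms
  by (intro smooth_on_intros smooth_on_vee smooth_on_trace) auto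

lemmas smooth_on_intros' = smooth_on_intros smooth_on_hat smooth_on_vee smooth_on_matrix_mult
  smooth_on_matrix_vector_mult smooth_on_cross3 smooth_on_transpose smooth_on_trace smooth_on_cay
  smooth_on_uncay

lemma subspace_range_hat: "subspace (range hat)"
  by (simp add: linear_hat linear_subspace_image)

text \<open>The chart at \<open>A0\<close> is a left translate of the Cayley transform; it reaches
  every rotation \<open>A\<close> for which \<open>transpose A0 ** A\<close> is not a half turn.
  Charts are modelled on a subspace of the ambient matrix space, so the parameter is a skew matrix
  instead of a vector.\<close>

lemma embedded_submanifold_SO3: "embedded_submanifold (dim (range hat)) SO3"
  unfolding embedded_submanifold_def
proof
  fix A0 :: "real^3^3" assume A0: "A0 \<in> SO3"
  define U where "U = {A :: real^3^3. 1 + trace (transpose A0 ** A) \<noteq> 0}"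
  define \<phi> where "\<phi> = (\<lambda>M. A0 ** cay (vee M))"
  define \<psi> where "\<psi> = (\<lambda>A. hat (uncay (transpose A0 ** A)))"
  have "smooth_on UNIV (\<lambda>A :: real^3^3. 1 + trace (transpose A0 ** A))"
    by (intro smooth_on_intros' open_UNIV)
  then have oU: "open U"
    unfolding U_def by (intro open_Collect_neq smooth_on_imp_continuous_on continuous_on_const)
  have x: "A0 \<in> U"
    using A0 by (simp add: U_def SO3_mult_transpose trace_def sum_3 mat_def)
  have \<phi>: "\<phi> M \<in> SO3 \<inter> U" "\<psi> (\<phi> M) = M" if "M \<in> range hat" for M
  proof -
    have "\<phi> M \<in> SO3"
      unfolding \<phi>_def by (intro SO3_mult A0 cay_SO3)
    moreover have "\<phi> M \<in> U"
      using one_plus_inner_pos[of "vee M"] by (simp add: \<phi>_def U_def SO3_cancel[OF A0] trace_cay)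
    ultimately show "\<phi> M \<in> SO3 \<inter> U" by blast
    show "\<psi> (\<phi> M) = M"
      using that by (auto simp: \<phi>_def \<psi>_def SO3_cancel[OF A0])
  qed
  have \<psi>: "\<phi> (\<psi> A) = A" "\<psi> A \<in> range hat" if "A \<in> SO3 \<inter> U" for A
  proof -
    have "transpose A0 ** A \<in> SO3"
      using that by (intro SO3_mult SO3_transpose A0) auto
    then show "\<phi> (\<psi> A) = A"
      using that cay_uncay by (simp add: \<phi>_def U_def \<psi>_def SO3_cancel[OF A0])
  qed (simp add: \<psi>_def)
  have "smooth_on UNIV \<phi>"
    unfolding \<phi>_def by (intro smooth_on_intros' open_UNIV)
  then have s\<phi>: "smooth_map (range hat) \<phi>"
    by (intro smooth_mapI[of UNIV _ \<phi>]) auto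
  have "smooth_on U \<psi>"
    unfolding \<psi>_def by (intro smooth_on_intros' oU) (simp add: U_def)
  then have s\<psi>: "smooth_map (SO3 \<inter> U) \<psi>"
    using oU by (intro smooth_mapI[of U _ \<psi>]) auto
  show "\<exists>U (S :: (real^3^3) set) N \<phi> \<psi>. open U \<and> A0 \<in> U \<and> subspace S \<and> dim S = dim (range hat) \<and>
        openin (top_of_set S) N \<and> smooth_map N \<phi> \<and> smooth_map (SO3 \<inter> U) \<psi> \<and>
        \<phi> ` N = SO3 \<inter> U \<and> \<psi> ` (SO3 \<inter> U) = N \<and>
        (\<forall>y\<in>N. \<psi> (\<phi> y) = y) \<and> (\<forall>z\<in>SO3 \<inter> U. \<phi> (\<psi> z) = z)"
  proof (rule exI[of _ U], rule exI[of _ "range hat"], rule exI[of _ "range hat"],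
      rule exI[of _ \<phi>], rule exI[of _ \<psi>], intro conjI)
    show "\<phi> ` range hat = SO3 \<inter> U"
    proof (intro equalityI subsetI)
      fix A assume A: "A \<in> SO3 \<inter> U"
      show "A \<in> \<phi> ` range hat"
        using \<psi>[OF A] by (metis imageI)
    qed (use \<phi>(1) in blast)
    show "\<psi> ` (SO3 \<inter> U) = range hat"
    proof (intro equalityI subsetI)
      fix M assume M: "M \<in> range hat"
      show "M \<in> \<psi> ` (SO3 \<inter> U)"
        using \<phi>[OF M] by (metis imageI)
    qed (use \<psi>(2) in blast)
  qed (use oU x s\<phi> s\<psi> \<phi> \<psi> subspace_range_hat in \<open>auto simp del: SO3_iff\<close>)
qed

subsection \<open>Spheres\<close>

lemma exists_embedded_submanifold_sphere:
  "\<exists>d. embedded_submanifold d (sphere (0 :: 'a::euclidean_space) r)"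
proof (cases "r > 0")
  \<comment> \<open>Radius 0 gives a point, as needed for the orbit of \<mu> = 0; a negative radius
    gives the empty set.\<close>
  case False
  have "embedded_submanifold 0 (sphere (0 :: 'a) r)"
    unfolding embedded_submanifold_def
  proof
    fix x :: 'a assume "x \<in> sphere 0 r"
    with False have "r = 0" "x = 0"
      by (auto simp: not_less)
    then show "\<exists>U (S :: 'a set) N \<phi> \<psi>. open U \<and> x \<in> U \<and> subspace S \<and> dim S = 0 \<and>
        openin (top_of_set S) N \<and> smooth_map N \<phi> \<and> smooth_map (sphere 0 r \<inter> U) \<psi> \<and>
        \<phi> ` N = sphere 0 r \<inter> U \<and> \<psi> ` (sphere 0 r \<inter> U) = N \<and>
        (\<forall>y\<in>N. \<psi> (\<phi> y) = y) \<and> (\<forall>z\<in>sphere 0 r \<inter> U. \<phi> (\<psi> z) = z)"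
      by (intro exI[of _ UNIV] exI[of _ "{0}"] exI[of _ "{0}"] exI[of _ "\<lambda>x. x"])
        (auto simp: subspace_single_0 intro: smooth_map_linear linear_ident)
  qed
  then show ?thesis ..
next
  case True
  \<comment> \<open>\<open>\<psi>\<close> is the stereographic projection from \<open>- P0\<close>.\<close>
  let ?M = "sphere (0 :: 'a) r"
  have "embedded_submanifold (DIM('a) - 1) ?M"
    unfolding embedded_submanifold_def
  proof
    fix P0 :: 'a assume "P0 \<in> ?M"
    then have P0: "P0 \<bullet> P0 = r\<^sup>2" "P0 \<noteq> 0"
      using True by (auto simp: power2_norm_eq_inner[symmetric])
    have M: "P \<in> ?M \<longleftrightarrow> P \<bullet> P = r\<^sup>2" for P :: 'a
      using True by (auto simp: power2_norm_eq_inner[symmetric] power2_eq_iff_nonneg)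
    define S where "S = {v. P0 \<bullet> v = 0}"
    \<comment> \<open>On the sphere only the antipode \<open>- P0\<close> is excluded, by the
      equality case of Cauchy-Schwarz.\<close>
    define U where "U = {P. r\<^sup>2 + P \<bullet> P0 \<noteq> 0}"
    define \<phi> where "\<phi> = (\<lambda>v. (1 / (r\<^sup>2 + v \<bullet> v)) *\<^sub>R ((2 * r\<^sup>2) *\<^sub>R v + (r\<^sup>2 - v \<bullet> v) *\<^sub>R P0))"
    define \<psi> where "\<psi> = (\<lambda>P. (1 / (r\<^sup>2 + P \<bullet> P0)) *\<^sub>R (r\<^sup>2 *\<^sub>R P - (P \<bullet> P0) *\<^sub>R P0))"
    have c: "r\<^sup>2 + v \<bullet> v \<noteq> 0" for v :: 'a
      using True by (smt (verit) inner_ge_zero zero_less_power)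
    have "smooth_on UNIV (\<lambda>P. r\<^sup>2 + P \<bullet> P0)"
      by (intro smooth_on_intros open_UNIV)
    then have oU: "open U"
      unfolding U_def by (intro open_Collect_neq smooth_on_imp_continuous_on continuous_on_const)
    have "smooth_on UNIV \<phi>"
      unfolding \<phi>_def using c by (intro smooth_on_intros open_UNIV)
    then have s\<phi>: "smooth_map S \<phi>"
      by (intro smooth_mapI[of UNIV _ \<phi>]) auto
    have "smooth_on U \<psi>"
      unfolding \<psi>_def by (intro smooth_on_intros oU) (simp add: U_def)
    then have s\<psi>: "smooth_map (?M \<inter> U) \<psi>"
      using oU by (intro smooth_mapI[of U _ \<psi>]) auto
    have \<phi>: "\<phi> v \<in> ?M \<inter> U" "\<psi> (\<phi> v) = v" if "v \<in> S" for v
    proof -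
      have v: "P0 \<bullet> v = 0" "v \<bullet> P0 = 0"
        using that by (auto simp: S_def inner_commute)
      have "\<phi> v \<bullet> \<phi> v = (1 / (r\<^sup>2 + v \<bullet> v))\<^sup>2 * ((2 * r\<^sup>2)\<^sup>2 * (v \<bullet> v) + (r\<^sup>2 - v \<bullet> v)\<^sup>2 * r\<^sup>2)"
        by (simp add: \<phi>_def inner_add_left inner_add_right v P0 power2_eq_square
            add_divide_distrib mult.assoc)
      also have "\<dots> = (1 / (r\<^sup>2 + v \<bullet> v))\<^sup>2 * (r\<^sup>2 * (r\<^sup>2 + v \<bullet> v)\<^sup>2)"
        by (simp add: power2_eq_square algebra_simps)
      also have "\<dots> = r\<^sup>2"
        using c[of v] by (simp add: power_divide)
      finally have "\<phi> v \<in> ?M" by (simp only: M)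
      have p: "\<phi> v \<bullet> P0 = (r\<^sup>2 - v \<bullet> v) * r\<^sup>2 / (r\<^sup>2 + v \<bullet> v)"
        by (simp add: \<phi>_def inner_add_left v P0)
      then have q: "r\<^sup>2 + \<phi> v \<bullet> P0 = 2 * r\<^sup>2 * r\<^sup>2 / (r\<^sup>2 + v \<bullet> v)"
        using c[of v] by (simp add: divide_simps) algebra
      then have "\<phi> v \<in> U"
        using c[of v] True by (simp add: U_def)
      with \<open>\<phi> v \<in> ?M\<close> show "\<phi> v \<in> ?M \<inter> U" ..
      have "r\<^sup>2 *\<^sub>R \<phi> v - (\<phi> v \<bullet> P0) *\<^sub>R P0 = (2 * r\<^sup>2 * r\<^sup>2 / (r\<^sup>2 + v \<bullet> v)) *\<^sub>R v"
        unfolding p by (simp add: \<phi>_def scaleR_add_right mult.commute)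
      then show "\<psi> (\<phi> v) = v"
        unfolding \<psi>_def q using c[of v] True by simp
    qed
    have \<psi>: "\<phi> (\<psi> P) = P" "\<psi> P \<in> S" if "P \<in> ?M \<inter> U" for P
    proof -
      define p where "p = P \<bullet> P0"
      have P: "P \<bullet> P = r\<^sup>2" "r\<^sup>2 + p \<noteq> 0" "P0 \<bullet> P = p" "P \<bullet> P0 = p"
        using that M by (auto simp: U_def p_def inner_commute)
      show "\<psi> P \<in> S"
        by (simp add: \<psi>_def S_def inner_diff_right P P0)
      have "\<psi> P \<bullet> \<psi> P = (1 / (r\<^sup>2 + p))\<^sup>2 * (r\<^sup>2 * (r\<^sup>2 * r\<^sup>2 - p\<^sup>2))"
        by (simp add: \<psi>_def inner_diff_left inner_diff_right P P0 power2_eq_square algebra_simps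
            add_divide_distrib diff_divide_distrib)
      also have "\<dots> = r\<^sup>2 * (r\<^sup>2 - p) / (r\<^sup>2 + p)"
        using P(2) by (simp add: divide_simps) algebra
      finally have q: "\<psi> P \<bullet> \<psi> P = r\<^sup>2 * (r\<^sup>2 - p) / (r\<^sup>2 + p)" .
      have q1: "r\<^sup>2 + \<psi> P \<bullet> \<psi> P = 2 * r\<^sup>2 * r\<^sup>2 / (r\<^sup>2 + p)"
        and q2: "r\<^sup>2 - \<psi> P \<bullet> \<psi> P = 2 * r\<^sup>2 * p / (r\<^sup>2 + p)"
        unfolding q using P(2) by (simp_all add: divide_simps) algebra+
      have "(2 * r\<^sup>2) *\<^sub>R \<psi> P + (2 * r\<^sup>2 * p / (r\<^sup>2 + p)) *\<^sub>R P0 = (2 * r\<^sup>2 * r\<^sup>2 / (r\<^sup>2 + p)) *\<^sub>R P"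
        by (simp add: \<psi>_def P scaleR_diff_right)
      then show "\<phi> (\<psi> P) = P"
        unfolding \<phi>_def q1 q2 using P(2) True by simp
    qed
    show "\<exists>U (S :: 'a set) N \<phi> \<psi>. open U \<and> P0 \<in> U \<and> subspace S \<and> dim S = DIM('a) - 1 \<and>
        openin (top_of_set S) N \<and> smooth_map N \<phi> \<and> smooth_map (?M \<inter> U) \<psi> \<and>
        \<phi> ` N = ?M \<inter> U \<and> \<psi> ` (?M \<inter> U) = N \<and>
        (\<forall>y\<in>N. \<psi> (\<phi> y) = y) \<and> (\<forall>z\<in>?M \<inter> U. \<phi> (\<psi> z) = z)"
    proof (rule exI[of _ U], rule exI[of _ S], rule exI[of _ S],
        rule exI[of _ \<phi>], rule exI[of _ \<psi>], intro conjI)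
      show "P0 \<in> U"
        using P0 True by (simp add: U_def)
      show "subspace S" "dim S = DIM('a) - 1"
        unfolding S_def using P0 by (simp_all add: subspace_hyperplane dim_hyperplane)
      show "\<phi> ` S = ?M \<inter> U"
      proof (intro equalityI subsetI)
        fix P assume P: "P \<in> ?M \<inter> U"
        show "P \<in> \<phi> ` S"
          using \<psi>[OF P] by (metis imageI)
      qed (use \<phi>(1) in blast)
      show "\<psi> ` (?M \<inter> U) = S"
      proof (intro equalityI subsetI)
        fix v assume v: "v \<in> S"
        show "v \<in> \<psi> ` (?M \<inter> U)"
          using \<phi>[OF v] by (metis imageI)
      qed (use \<psi>(2) in blast)
    qed (use oU s\<phi> s\<psi> \<phi> \<psi> in auto)
  qed
  then show ?thesis ..
qed

lemma cay_mult_vector: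
  "cay w *v x = (1 / (1 + w \<bullet> w)) *\<^sub>R ((1 - w \<bullet> w) *\<^sub>R x + (2 * (w \<bullet> x)) *\<^sub>R w + 2 *\<^sub>R cross3 w x)"
proof -
  have "(\<chi> i j. w$i * w$j) *v x = (w \<bullet> x) *\<^sub>R w"
    by (simp add: vec_eq_iff matrix_vector_mult_def inner_vec_def sum_3 algebra_simps)
  then show ?thesis
    by (simp add: cay_def scaleR_matrix_vector_assoc[symmetric] matrix_vector_mult_add_rdistrib
        hat_mult_vector)
qed

text \<open>The rotation turns about the axis \<open>cross3 P0 P\<close> by the angle \<theta>
  between the two vectors, so the parameter must have length \<open>tan (\<theta> / 2)\<close>,
  which is sine over one plus cosine; multiplying through by \<open>P0 \<bullet> P0\<close> gives
  the stated factor. In the computation \<open>w\<close> is orthogonal to \<open>P0\<close>, and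
  \<open>cross3 w P0\<close> comes from the double cross product formula.\<close>

lemma cay_moves:
  assumes "norm P = norm P0" "P0 \<bullet> P0 + P0 \<bullet> P \<noteq> 0"
  shows "cay ((1 / (P0 \<bullet> P0 + P0 \<bullet> P)) *\<^sub>R cross3 P0 P) *v P0 = P"
proof -
  define p q w where "p = P0 \<bullet> P" and "q = P0 \<bullet> P0" and "w = (1 / (q + p)) *\<^sub>R cross3 P0 P"
  have d: "q + p \<noteq> 0" and P: "P \<bullet> P = q"
    using assms by (simp_all add: p_def q_def dot_square_norm)
  have "q * q - p * p = (q - p) * (q + p)"
    by algebra
  then have c: "w \<bullet> w = (q - p) / (q + p)"
    using d by (simp add: w_def dot_cross P p_def[symmetric] q_def[symmetric] inner_commute[of P P0]
        divide_simps)
  have n: "1 + w \<bullet> w = 2 * q / (q + p)" "1 - w \<bullet> w = 2 * p / (q + p)"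
    unfolding c using d by (simp_all add: divide_simps)
  have "q \<noteq> 0"
    using n(1) one_plus_inner_pos[of w] by auto
  have "w \<bullet> P0 = 0"
    by (simp add: w_def dot_cross_self inner_commute)
  moreover have "cross3 w P0 = (1 / (q + p)) *\<^sub>R (q *\<^sub>R P - p *\<^sub>R P0)"
    using Lagrange[of P0 P0 P] cross_skew[of "cross3 P0 P" P0]
    by (simp add: w_def cross_mult_left p_def q_def)
  ultimately show ?thesis
    using d \<open>q \<noteq> 0\<close> unfolding p_def[symmetric] q_def[symmetric] w_def[symmetric]
    by (simp add: cay_mult_vector n scaleR_diff_right)
qed

text \<open>Together with \<open>P\<close> itself the map \<open>s\<close> gives a point of the
  level set over \<open>P\<close>. The transpose of the rotation in \<open>cay_moves\<close> carries
  \<open>P\<close> back to \<open>P0\<close>, and a fixed rotation \<open>A0\<close> carries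
  \<open>P0\<close> to \<mu>. For \<mu> = 0 the denominator would vanish, but the sphere is then one
  point and the identity serves.\<close>

lemma sphere_local_section:
  assumes "P0 \<in> sphere 0 (norm \<mu>)"
  obtains U s where "open U" "P0 \<in> U" "smooth_on U s"
    "\<And>P. P \<in> sphere 0 (norm \<mu>) \<inter> U \<Longrightarrow> s P \<in> SO3 \<and> s P *v P = \<mu>"
proof (cases "\<mu> = 0")
  case True
  then show ?thesis
    using that[of UNIV "\<lambda>_. mat 1"] SO3_one smooth_on_const by auto
next
  case False
  define U where "U = {P. P0 \<bullet> P0 + P0 \<bullet> P \<noteq> 0}"
  obtain A0 where A0: "A0 \<in> SO3" "A0 *v P0 = \<mu>"
    using SO3_transitive[of P0 \<mu>] assms by auto
  define s where "s = (\<lambda>P. A0 ** transpose (cay ((1 / (P0 \<bullet> P0 + P0 \<bullet> P)) *\<^sub>R cross3 P0 P)))"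
  have "smooth_on UNIV (\<lambda>P. P0 \<bullet> P0 + P0 \<bullet> P)"
    by (intro smooth_on_intros open_UNIV)
  then have oU: "open U"
    unfolding U_def by (intro open_Collect_neq smooth_on_imp_continuous_on continuous_on_const)
  show ?thesis
  proof
    show "open U" by fact
    show "P0 \<in> U"
      using assms False by (auto simp: U_def)
    show "smooth_on U s"
      unfolding s_def by (intro smooth_on_intros' oU) (simp add: U_def)
    fix P assume "P \<in> sphere 0 (norm \<mu>) \<inter> U"
    then have "norm P = norm P0" "P0 \<bullet> P0 + P0 \<bullet> P \<noteq> 0"
      using assms by (auto simp: U_def)
    from cay_moves[OF this] have "s P *v P = A0 *v P0"
      unfolding s_def using SO3_cancel(3)[OF cay_SO3] by (metis matrix_vector_mul_assoc)
    moreover have "s P \<in> SO3"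
      unfolding s_def by (intro SO3_mult SO3_transpose cay_SO3 A0)
    ultimately show "s P \<in> SO3 \<and> s P *v P = \<mu>"
      using A0 by simp
  qed
qed

subsection \<open>Tangent spaces and the two forms\<close>

text \<open>Turning \<open>A\<close> by a rotation on the right and \<open>P\<close> by its
  transpose keeps \<open>A *v P\<close> fixed. These are the two nontrivial components of curves in
  the level set.\<close>

lemma SO3_curve:
  assumes "A \<in> SO3"
  shows "((\<lambda>s. A ** cay ((s / 2) *\<^sub>R \<xi>)) has_vector_derivative A ** hat \<xi>) (at 0)"
    and "((\<lambda>s. transpose (cay ((s / 2) *\<^sub>R \<xi>)) *v P) has_vector_derivative cross3 P \<xi>) (at 0)"
proof -
  have "linear ((**) A)"
    using bilinear_matrix_mult by (auto simp: bilinear_def)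
  then show "((\<lambda>s. A ** cay ((s / 2) *\<^sub>R \<xi>)) has_vector_derivative A ** hat \<xi>) (at 0)"
    using bounded_linear.has_vector_derivative[OF _ has_vector_derivative_cay, of "(**) A"]
    by (simp only: linear_conv_bounded_linear)
  have "linear (\<lambda>M :: real^3^3. transpose M *v P)"
    using linear_compose[OF linear_transpose, of "\<lambda>M. M *v P"] bilinear_matrix_vector_mult
    by (auto simp: bilinear_def o_def)
  then have "((\<lambda>s. transpose (cay ((s / 2) *\<^sub>R \<xi>)) *v P) has_vector_derivative
      transpose (hat \<xi>) *v P) (at 0)"
    using bounded_linear.has_vector_derivative[OF _ has_vector_derivative_cay,
        of "\<lambda>M. transpose M *v P"]
    by (simp only: linear_conv_bounded_linear)
  moreover have "transpose (hat \<xi>) *v P = cross3 P \<xi>"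
    using cross_skew[of P \<xi>]
    by (simp add: transpose_hat hat_mult_vector linear_neg[OF bilinear_matrix_vector_mult[unfolded
          bilinear_def, THEN conjunct2, rule_format]])
  ultimately show "((\<lambda>s. transpose (cay ((s / 2) *\<^sub>R \<xi>)) *v P) has_vector_derivative
      cross3 P \<xi>) (at 0)"
    by simp
qed

text \<open>Differentiating \<open>transpose A ** A = mat 1\<close> shows that
  \<open>transpose A ** A'\<close> is skew; conversely a Cayley curve in \<open>A\<close> and
  straight lines in the other coordinates realise every such vector.\<close>

lemma tangent_space_TQ:
  assumes "A \<in> SO3"
  shows "tangent_space TQ (A, P, a, l) = {(A ** hat \<xi>, P', a', l') |\<xi> P' a' l'. True}"
proof (intro equalityI subsetI)
  fix v assume v: "v \<in> tangent_space TQ (A, P, a, l)"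
  obtain A' P' a' l' where v_eq: "v = (A', P', a', l')" by (metis prod.exhaust)
  have "((\<lambda>x :: phase. transpose (fst x) ** fst x) has_derivative
      (\<lambda>w. transpose A ** fst w + transpose (fst w) ** A)) (at (A, P, a, l))"
    using bounded_bilinear.FDERIV[OF bilinear_matrix_mult[unfolded bilinear_conv_bounded_bilinear],
        of "\<lambda>x :: phase. transpose (fst x)" "\<lambda>x. transpose (fst x)" _ _ fst fst]
      linear_imp_has_derivative_at[OF linear_fst]
      linear_imp_has_derivative_at[OF linear_compose[OF linear_fst linear_transpose]]
    by (fastforce simp: o_def)
  from tangent_space_level[OF v this, where c = "mat 1"]
  have "transpose A ** A' + transpose A' ** A = 0"
    using SO3_mult_transpose by (auto simp: TQ_def v_eq)
  then have "transpose (transpose A ** A') = - (transpose A ** A')"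
    by (simp add: matrix_transpose_mul add_eq_0_iff)
  then have "A' = A ** hat (vee (transpose A ** A'))"
    by (simp add: hat_vee_skew SO3_cancel[OF assms])
  then show "v \<in> {(A ** hat \<xi>, P', a', l') |\<xi> P' a' l'. True}"
    using v_eq by blast
next
  fix v :: phase assume "v \<in> {(A ** hat \<xi>, P', a', l') |\<xi> P' a' l'. True}"
  then obtain \<xi> P' a' l' where v: "v = (A ** hat \<xi>, P', a', l')" by blast
  have "A ** cay ((s / 2) *\<^sub>R \<xi>) \<in> SO3" for s
    by (rule SO3_mult[OF assms cay_SO3])
  then show "v \<in> tangent_space TQ (A, P, a, l)"
    unfolding v
    by (intro tangent_spaceI[of "\<lambda>s. (A ** cay ((s / 2) *\<^sub>R \<xi>), P + s *\<^sub>R P', a + s * a', l + s * l')"])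
      (auto simp: TQ_def intro!: derivative_eq_intros SO3_curve assms)
qed

lemma tangent_space_mono: "M \<subseteq> N \<Longrightarrow> tangent_space M x \<subseteq> tangent_space N x"
  by (auto simp: tangent_space_def curve_in_def)

lemma mem_level_set: "(A, P, a, l) \<in> level_set TQ J_Q \<mu> \<longleftrightarrow> A \<in> SO3 \<and> A *v P = \<mu>"
  by (simp add: level_set_def TQ_def J_Q_def)

lemma level_set_subset: "level_set M J \<mu> \<subseteq> M"
  by (auto simp: level_set_def)

lemma has_derivative_J_Q:
  "(J_Q has_derivative (\<lambda>(A', P', a', l'). A *v P' + A' *v P)) (at (A, P, a, l))"
proof -
  have "linear (\<lambda>x :: phase. fst (snd x))"
    by (simp add: linear_iff)
  then have "((\<lambda>x :: phase. fst x *v fst (snd x)) has_derivative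
      (\<lambda>w. A *v fst (snd w) + fst w *v P)) (at (A, P, a, l))"
    using bounded_bilinear.FDERIV[OF bilinear_matrix_vector_mult[unfolded bilinear_conv_bounded_bilinear],
        of fst fst "(A, P, a, l)" UNIV "\<lambda>x :: phase. fst (snd x)" "\<lambda>x. fst (snd x)"]
      linear_imp_has_derivative_at[OF linear_fst] linear_imp_has_derivative_at
    by fastforce
  then show ?thesis
    by (simp add: J_Q_def case_prod_beta')
qed

text \<open>The derivative of \<open>A *v P\<close> is \<open>A *v (P' + cross3 \<xi> P)\<close>,
  and \<open>A\<close> is invertible, so \<xi> determines \<open>P'\<close>. For the converse the
  body momentum is turned back along the curve to hold the spatial momentum at \<mu>.\<close>

lemma tangent_space_level_set:
  assumes "(A, P, a, l) \<in> level_set TQ J_Q \<mu>"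
  shows "tangent_space (level_set TQ J_Q \<mu>) (A, P, a, l) =
    {(A ** hat \<xi>, cross3 P \<xi>, a', l') |\<xi> a' l'. True}"
proof (intro equalityI subsetI)
  have A: "A \<in> SO3"
    using assms by (simp add: mem_level_set)
  fix v assume v: "v \<in> tangent_space (level_set TQ J_Q \<mu>) (A, P, a, l)"
  then have "v \<in> tangent_space TQ (A, P, a, l)"
    by (rule subsetD[OF tangent_space_mono[OF level_set_subset]])
  then obtain \<xi> P' a' l' where v_eq: "v = (A ** hat \<xi>, P', a', l')"
    unfolding tangent_space_TQ[OF A] by blast
  have "(case v of (A', P', a', l') \<Rightarrow> A *v P' + A' *v P) = 0"
    by (rule tangent_space_level[OF v has_derivative_J_Q]) (simp add: level_set_def)
  then have "A *v (P' + cross3 \<xi> P) = 0"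
    by (simp add: v_eq matrix_vector_mul_assoc[symmetric] hat_mult_vector matrix_vector_right_distrib)
  then have "P' + cross3 \<xi> P = 0"
    by (metis SO3_cancel(3)[OF A] matrix_vector_mult_0_right)
  then have "P' = cross3 P \<xi>"
    using cross_skew[of P \<xi>] by (simp add: add_eq_0_iff2)
  then show "v \<in> {(A ** hat \<xi>, cross3 P \<xi>, a', l') |\<xi> a' l'. True}"
    using v_eq by blast
next
  have A: "A \<in> SO3" "A *v P = \<mu>"
    using assms by (auto simp: mem_level_set)
  fix v :: phase assume "v \<in> {(A ** hat \<xi>, cross3 P \<xi>, a', l') |\<xi> a' l'. True}"
  then obtain \<xi> a' l' where v: "v = (A ** hat \<xi>, cross3 P \<xi>, a', l')" by blast
  let ?c = "\<lambda>s. cay ((s / 2) *\<^sub>R \<xi>)"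
  have "A ** ?c s \<in> SO3" "(A ** ?c s) *v (transpose (?c s) *v P) = \<mu>" for s
    using SO3_mult[OF A(1) cay_SO3] SO3_cancel(4)[OF cay_SO3] A(2)
    by (auto simp: matrix_vector_mul_assoc[symmetric])
  then show "v \<in> tangent_space (level_set TQ J_Q \<mu>) (A, P, a, l)"
    unfolding v
    by (intro tangent_spaceI[of "\<lambda>s. (A ** ?c s, transpose (?c s) *v P, a + s * a', l + s * l')"])
      (auto simp: mem_level_set intro!: derivative_eq_intros SO3_curve[OF A(1)])
qed

lemma linear_proj_red: "linear proj_red"
  by (auto simp: linear_iff proj_red_def)

lemma mem_orbit_space: "(P, a, l) \<in> orbit_space \<mu> \<longleftrightarrow> norm P = norm \<mu>"
  by (simp add: orbit_space_def coadjoint_orbit_eq_sphere)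

lemma proj_red_level_set: "proj_red ` level_set TQ J_Q \<mu> = orbit_space \<mu>"
proof (intro equalityI subsetI)
  fix y assume "y \<in> proj_red ` level_set TQ J_Q \<mu>"
  then obtain A P a l where "y = (P, a, l)" "A \<in> SO3" "A *v P = \<mu>"
    by (auto simp: proj_red_def level_set_def TQ_def J_Q_def)
  moreover from this have "norm P = norm \<mu>"
    using SO3_inner[of A P P] by (simp add: norm_eq_sqrt_inner)
  ultimately show "y \<in> orbit_space \<mu>"
    by (simp add: mem_orbit_space)
next
  fix y assume y: "y \<in> orbit_space \<mu>"
  obtain P a l where y_eq: "y = (P, a, l)" by (metis prod.exhaust)
  then obtain A where "A \<in> SO3" "A *v P = \<mu>"
    using y SO3_transitive[of P \<mu>] by (auto simp: mem_orbit_space)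
  then have "(A, P, a, l) \<in> level_set TQ J_Q \<mu>" "y = proj_red (A, P, a, l)"
    by (auto simp: mem_level_set proj_red_def y_eq)
  then show "y \<in> proj_red ` level_set TQ J_Q \<mu>" by blast
qed

text \<open>The double cross product \<open>cross3 P (cross3 v P)\<close> is
  \<open>(P \<bullet> P) *\<^sub>R v - (P \<bullet> v) *\<^sub>R P\<close>. So every vector
  orthogonal to a nonzero \<open>P\<close> has the form \<open>cross3 P \<xi>\<close>.\<close>

lemma cross3_inverse:
  assumes "P \<noteq> 0" "P \<bullet> v = 0"
  shows "cross3 P ((1 / (P \<bullet> P)) *\<^sub>R cross3 v P) = v"
  using assms by (simp add: cross_mult_right Lagrange)

lemma tangent_space_orbit_space:
  assumes "(P, a, l) \<in> orbit_space \<mu>"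
  shows "tangent_space (orbit_space \<mu>) (P, a, l) = {(cross3 P \<xi>, a', l') |\<xi> a' l'. True}"
proof (intro equalityI subsetI)
  fix v assume v: "v \<in> tangent_space (orbit_space \<mu>) (P, a, l)"
  obtain P' a' l' where v_eq: "v = (P', a', l')" by (metis prod.exhaust)
  have "((\<lambda>y :: reduced. fst y \<bullet> fst y) has_derivative (\<lambda>w. P \<bullet> fst w + fst w \<bullet> P)) (at (P, a, l))"
    by (auto intro!: derivative_eq_intros)
  from tangent_space_level[OF v this, where c = "\<mu> \<bullet> \<mu>"] have 1: "P \<bullet> P' = 0"
    by (auto simp: orbit_space_def coadjoint_orbit_eq_sphere v_eq inner_commute dot_square_norm)
  \<comment> \<open>At \<open>P = 0\<close> the orthogonality relation is empty; there the orbit is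
    a point, so the first component is constant along curves.\<close>
  have 2: "P' = 0" if "P = 0"
  proof -
    have "fst y = 0" if "y \<in> orbit_space \<mu>" for y
      using assms that \<open>P = 0\<close>
      by (simp add: orbit_space_def coadjoint_orbit_eq_sphere mem_Times_iff)
    then have "fst v = 0"
      by (rule tangent_space_level[OF v linear_imp_has_derivative_at[OF linear_fst]])
    then show ?thesis by (simp add: v_eq)
  qed
  have "\<exists>\<xi>. P' = cross3 P \<xi>"
  proof (cases "P = 0")
    case True
    then show ?thesis using 2 by simp
  next
    case False
    then show ?thesis using cross3_inverse[OF False 1] by metis
  qed
  then show "v \<in> {(cross3 P \<xi>, a', l') |\<xi> a' l'. True}"
    using v_eq by blast
next
  fix v :: reduced assume "v \<in> {(cross3 P \<xi>, a', l') |\<xi> a' l'. True}"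
  then obtain \<xi> a' l' where v: "v = (cross3 P \<xi>, a', l')" by blast
  \<comment> \<open>Curves on the orbit are not built directly: the vector is lifted to the level
    set, where its curve is known, and projected.\<close>
  obtain A where "(A, P, a, l) \<in> level_set TQ J_Q \<mu>"
    using assms SO3_transitive[of P \<mu>] by (auto simp: mem_orbit_space mem_level_set)
  then have "(A ** hat \<xi>, cross3 P \<xi>, a', l') \<in> tangent_space (level_set TQ J_Q \<mu>) (A, P, a, l)"
    unfolding tangent_space_level_set[OF \<open>(A, P, a, l) \<in> _\<close>] by blast
  from tangent_space_image[OF this linear_imp_has_derivative_at[OF linear_proj_red]
      eq_refl[OF proj_red_level_set]]
  show "v \<in> tangent_space (orbit_space \<mu>) (P, a, l)"
    by (simp add: proj_red_def v)
qed

section \<open>The canonical form and the orbit form on tangent vectors\<close>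

lemma omega_Q_eq:
  "omega_Q (A, P, a, l) (A1, P1, a1, l1) (A2, P2, a2, l2) =
     (P2 \<bullet> vee (transpose A ** A1) + P \<bullet> vee (transpose A2 ** A1) + l2 * a1)
     - (P1 \<bullet> vee (transpose A ** A2) + P \<bullet> vee (transpose A1 ** A2) + l1 * a2)"
proof -
  have "((\<lambda>y. canonical_one_form y (A', P', a', l')) has_derivative
      (\<lambda>(B, R, b, k). R \<bullet> vee (transpose A ** A') + P \<bullet> vee (transpose B ** A') + k * a'))
      (at (A, P, a, l))" for A' P' a' l'
  proof -
    have "linear (\<lambda>y :: phase. vee (transpose (fst y) ** A'))"
      using linear_compose[OF linear_compose[OF linear_compose[OF linear_fst linear_transpose],
          of "\<lambda>M. M ** A'"] linear_vee] bilinear_matrix_mult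
      by (auto simp: bilinear_def o_def)
    from linear_imp_has_derivative_at[OF this]
    have "((\<lambda>y :: phase. fst (snd y) \<bullet> vee (transpose (fst y) ** A') + snd (snd (snd y)) * a')
        has_derivative (\<lambda>w. fst (snd w) \<bullet> vee (transpose A ** A')
          + P \<bullet> vee (transpose (fst w) ** A') + snd (snd (snd w)) * a')) (at (A, P, a, l))"
      by (auto intro!: derivative_eq_intros)
    then show ?thesis
      by (simp add: canonical_one_form_def case_prod_beta')
  qed
  from frechet_derivative_at[OF this, symmetric] show ?thesis
    by (simp add: omega_Q_def ext_deriv1_def)
qed

text \<open>All matrices occur in products of the form
  \<open>transpose (A ** B) ** (A ** C)\<close>, so \<open>A\<close> cancels. The two remaining
  products each contribute half of \<open>P \<bullet> cross3 \<xi> \<eta>\<close>.\<close>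

lemma omega_Q_tangent:
  assumes "A \<in> SO3"
  shows "omega_Q (A, P, a, l) (A ** hat \<xi>, P1, a1, l1) (A ** hat \<eta>, P2, a2, l2) =
    P2 \<bullet> \<xi> - P1 \<bullet> \<eta> + P \<bullet> cross3 \<xi> \<eta> + l2 * a1 - l1 * a2"
proof -
  have "transpose (A ** B) ** (A ** C) = transpose B ** C" for B C :: "real^3^3"
    by (simp add: matrix_transpose_mul matrix_mul_assoc[symmetric] SO3_cancel[OF assms])
  then show ?thesis
    using cross_skew[of \<xi> \<eta>]
    by (simp add: omega_Q_eq SO3_cancel[OF assms] vee_transpose_hat_mult)
qed

text \<open>The value does not depend on the representatives: the triple product is
  \<open>cross3 P \<xi> \<bullet> \<eta>\<close> and also
  \<open>- (cross3 P \<eta> \<bullet> \<xi>)\<close>, so \<xi> and \<eta> can be changed one at a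
  time as long as their cross products with \<open>P\<close> stay the same.\<close>

lemma orbit_form_minus_eq:
  "orbit_form_minus P (cross3 P \<xi>) (cross3 P \<eta>) = - (P \<bullet> cross3 \<xi> \<eta>)"
  unfolding orbit_form_minus_def
proof (rule the_equality)
  fix c assume "\<exists>\<xi>' \<eta>'. cross3 P \<xi> = cross3 P \<xi>' \<and> cross3 P \<eta> = cross3 P \<eta>' \<and> c = - (P \<bullet> cross3 \<xi>' \<eta>')"
  then obtain \<xi>' \<eta>' where *: "cross3 P \<xi> = cross3 P \<xi>'" "cross3 P \<eta> = cross3 P \<eta>'"
    "c = - (P \<bullet> cross3 \<xi>' \<eta>')" by blast
  have "P \<bullet> cross3 \<xi>' \<eta>' = cross3 P \<xi>' \<bullet> \<eta>'" for \<xi>' \<eta>'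
    by (metis cross_triple inner_commute)
  moreover have "P \<bullet> cross3 \<xi>' \<eta>' = - (cross3 P \<eta>' \<bullet> \<xi>')" for \<xi>' \<eta>'
    by (metis calculation cross_skew inner_minus_right minus_minus)
  ultimately show "c = - (P \<bullet> cross3 \<xi> \<eta>)"
    using * by metis
qed blast

lemma omega_red_tangent:
  "omega_red (P, a, l) (cross3 P \<xi>, a1, l1) (cross3 P \<eta>, a2, l2) =
    - (P \<bullet> cross3 \<xi> \<eta>) + (l2 * a1 - l1 * a2)"
  by (simp add: omega_red_def orbit_form_minus_eq)

subsection \<open>Symplectic structures and the action\<close>

text \<open>Projections instead of tuples make the rules for smoothness and derivatives applicable
  at a variable point.\<close>

lemma omega_Q_proj:
  "omega_Q x v w =
     (fst (snd w) \<bullet> vee (transpose (fst x) ** fst v) + fst (snd x) \<bullet> vee (transpose (fst w) ** fst v)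
       + snd (snd (snd w)) * fst (snd (snd v)))
     - (fst (snd v) \<bullet> vee (transpose (fst x) ** fst w) + fst (snd x) \<bullet> vee (transpose (fst v) ** fst w)
       + snd (snd (snd v)) * fst (snd (snd w)))"
  using omega_Q_eq[of "fst x" "fst (snd x)" "fst (snd (snd x))" "snd (snd (snd x))"
      "fst v" "fst (snd v)" "fst (snd (snd v))" "snd (snd (snd v))"
      "fst w" "fst (snd w)" "fst (snd (snd w))" "snd (snd (snd w))"]
  by simp

lemma linear_vee_transpose_mult:
  "linear (\<lambda>B. vee (transpose B ** A))" "linear (\<lambda>B. vee (transpose A ** B))"
  using linear_compose[OF linear_compose[OF linear_transpose, of "\<lambda>M. M ** A"] linear_vee]
    linear_compose[of "\<lambda>M. transpose A ** M", OF _ linear_vee] bilinear_matrix_mult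
  by (auto simp: bilinear_def o_def)

lemma bilinear_omega_Q: "bilinear (omega_Q x)"
  unfolding bilinear_def linear_iff omega_Q_proj
  by (simp add: linear_vee_transpose_mult[THEN linear_add] linear_vee_transpose_mult[THEN linear_scale]
      inner_add_left inner_add_right algebra_simps)

lemma has_derivative_omega_Q:
  "((\<lambda>y. omega_Q y v w) has_derivative
     (\<lambda>z. fst (snd w) \<bullet> vee (transpose (fst z) ** fst v) + fst (snd z) \<bullet> vee (transpose (fst w) ** fst v)
       - (fst (snd v) \<bullet> vee (transpose (fst z) ** fst w) + fst (snd z) \<bullet> vee (transpose (fst v) ** fst w))))
     (at x)"
proof -
  have [derivative_intros]: "((\<lambda>y :: phase. vee (transpose (fst y) ** A)) has_derivative
      (\<lambda>z. vee (transpose (fst z) ** A))) (at x)" for A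
    using linear_imp_has_derivative_at[OF linear_compose[OF linear_fst linear_vee_transpose_mult(1)]]
    by (simp add: o_def)
  show ?thesis
    unfolding omega_Q_proj by (auto intro!: derivative_eq_intros)
qed

text \<open>\<open>omega_Q\<close> is exact already as an ambient form, so this holds for all
  vectors, tangent or not: the cyclic sum cancels by symmetry of the second derivatives of the
  one-form.\<close>

lemma ext_deriv2_omega_Q: "ext_deriv2 omega_Q x u v w = 0"
  by (simp add: ext_deriv2_def frechet_derivative_at[OF has_derivative_omega_Q, symmetric])

text \<open>Test vectors with only a momentum component determine \<xi>; after that the terms
  containing \<open>P\<close> agree and \<eta> determines \<open>P1\<close>. Stated as injectivity,
  it gives nondegeneracy and also the uniqueness of Hamiltonian vectors.\<close>

lemma omega_Q_inject:
  assumes A: "A \<in> SO3"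
    and v: "v \<in> tangent_space TQ (A, P, a, l)" and v': "v' \<in> tangent_space TQ (A, P, a, l)"
    and eq: "\<And>w. w \<in> tangent_space TQ (A, P, a, l) \<Longrightarrow>
      omega_Q (A, P, a, l) v w = omega_Q (A, P, a, l) v' w"
  shows "v = v'"
proof -
  obtain \<xi> P1 a1 l1 where v: "v = (A ** hat \<xi>, P1, a1, l1)"
    using v unfolding tangent_space_TQ[OF A] by blast
  obtain \<xi>' P1' a1' l1' where v': "v' = (A ** hat \<xi>', P1', a1', l1')"
    using v' unfolding tangent_space_TQ[OF A] by blast
  have *: "P2 \<bullet> \<xi> - P1 \<bullet> \<eta> + P \<bullet> cross3 \<xi> \<eta> + l2 * a1 - l1 * a2 =
      P2 \<bullet> \<xi>' - P1' \<bullet> \<eta> + P \<bullet> cross3 \<xi>' \<eta> + l2 * a1' - l1' * a2" for \<eta> P2 a2 l2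
    using eq[of "(A ** hat \<eta>, P2, a2, l2)"]
    unfolding v v' omega_Q_tangent[OF A] tangent_space_TQ[OF A] by blast
  have "P2 \<bullet> \<xi> = P2 \<bullet> \<xi>'" for P2
    using *[of P2 0 0 0] by simp
  then have "\<xi> = \<xi>'"
    using vector_eq_ldot by blast
  moreover from this have "P1 \<bullet> \<eta> = P1' \<bullet> \<eta>" for \<eta>
    using *[of 0 \<eta> 0 0] by simp
  then have "P1 = P1'"
    using vector_eq_rdot by blast
  ultimately show ?thesis
    using *[of 0 0 1 0] *[of 0 0 0 1] by (simp add: v v')
qed

lemma zero_tangent_space_TQ: "A \<in> SO3 \<Longrightarrow> 0 \<in> tangent_space TQ (A, P, a, l)"
  unfolding tangent_space_TQ using linear_0[OF linear_hat]
  by (auto simp: zero_prod_def intro!: exI[of _ 0])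

lemma symplectic_manifold_TQ: "symplectic_manifold TQ omega_Q"
  unfolding symplectic_manifold_def
proof (intro conjI ballI impI)
  show "\<exists>d. embedded_submanifold d TQ"
    unfolding TQ_def using embedded_submanifold_Times_UNIV[OF embedded_submanifold_SO3] by blast
  have "smooth_on UNIV (\<lambda>y. omega_Q y v w)" for v w
    unfolding omega_Q_proj by (intro smooth_on_intros' open_UNIV)
  moreover have "omega_Q y v v = 0" for y v
    by (simp add: omega_Q_proj)
  ultimately show "closed_two_form TQ omega_Q"
    unfolding closed_two_form_def using bilinear_omega_Q ext_deriv2_omega_Q
    by (intro ballI exI[of _ UNIV] exI[of _ omega_Q]) auto
  fix x v assume x: "x \<in> TQ" and v: "v \<in> tangent_space TQ x"
    and eq: "\<forall>w\<in>tangent_space TQ x. omega_Q x v w = 0"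
  obtain A P a l where x_eq: "x = (A, P, a, l)" by (metis prod.exhaust)
  have A: "A \<in> SO3"
    using x by (simp add: x_eq TQ_def)
  show "v = 0"
    using omega_Q_inject[OF A v[unfolded x_eq] zero_tangent_space_TQ[OF A]] eq
      bilinear_lzero[OF bilinear_omega_Q]
    by (simp add: x_eq)
qed

text \<open>Since \<open>P \<bullet> ((P \<times> \<xi>) \<times> (P \<times> \<eta>)) = |P|\<^sup>2 (P \<bullet> (\<xi> \<times> \<eta>))\<close> and \<open>|P| = |\<mu>|\<close> on the orbit, \<open>c = - 1 / |\<mu>|\<^sup>2\<close>
  gives an ambient extension of \<open>omega_red\<close>; for \<open>\<mu> = 0\<close> the junk value \<open>c = 0\<close> is the right one.\<close>

definition omega_red_extension :: "real \<Rightarrow> reduced \<Rightarrow> reduced \<Rightarrow> reduced \<Rightarrow> real" where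
  "omega_red_extension c y v w = c * (fst y \<bullet> cross3 (fst v) (fst w))
     + (snd (snd w) * fst (snd v) - snd (snd v) * fst (snd w))"

lemma inner_cross3_cross3_cross3:
  "P \<bullet> cross3 (cross3 P \<xi>) (cross3 P \<eta>) = (P \<bullet> P) * (P \<bullet> cross3 \<xi> \<eta>)"
  by (simp add: inner_vec_def sum_3 cross_components algebra_simps)

text \<open>The three vectors lie in the plane orthogonal to \<open>P\<close>, or all vanish. The
  exterior derivative of the extended orbit form is a multiple of the ambient volume form, so it is
  zero on tangent vectors only.\<close>

lemma cross3_triple_tangent: "cross3 P \<xi> \<bullet> cross3 (cross3 P \<eta>) (cross3 P \<zeta>) = 0"
  by (simp add: inner_vec_def sum_3 cross_components algebra_simps)

lemma omega_red_extension_eq: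
  assumes "(P, a, l) \<in> orbit_space \<mu>"
    and "v \<in> tangent_space (orbit_space \<mu>) (P, a, l)" "w \<in> tangent_space (orbit_space \<mu>) (P, a, l)"
  shows "omega_red_extension (- 1 / (\<mu> \<bullet> \<mu>)) (P, a, l) v w = omega_red (P, a, l) v w"
proof -
  obtain \<xi> a1 l1 \<eta> a2 l2 where vw: "v = (cross3 P \<xi>, a1, l1)" "w = (cross3 P \<eta>, a2, l2)"
    using assms unfolding tangent_space_orbit_space[OF assms(1)] by blast
  have "\<mu> \<bullet> \<mu> = P \<bullet> P"
    using assms(1) by (simp add: mem_orbit_space dot_square_norm)
  then show ?thesis
    unfolding vw omega_red_tangent
    by (cases "P = 0") (simp_all add: omega_red_extension_def inner_cross3_cross3_cross3)
qed

lemma bilinear_omega_red_extension: "bilinear (omega_red_extension c y)"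
  by (auto simp: bilinear_def linear_iff omega_red_extension_def cross_add_left cross_add_right
      cross_mult_left cross_mult_right inner_add_right algebra_simps)

lemma frechet_derivative_omega_red_extension:
  "frechet_derivative (\<lambda>y. omega_red_extension c y v w) (at x) =
     (\<lambda>z. c * (fst z \<bullet> cross3 (fst v) (fst w)))"
  unfolding omega_red_extension_def
  by (rule frechet_derivative_at[symmetric]) (auto intro!: derivative_eq_intros)

text \<open>The orbit term is \<open>- (cross3 P \<xi> \<bullet> \<eta>)\<close> with \<eta> ranging
  over the whole space, so it recovers the tangent vector, though not \<xi> itself.\<close>

lemma omega_red_inject:
  assumes y: "(P, a, l) \<in> orbit_space \<mu>"
    and v: "v \<in> tangent_space (orbit_space \<mu>) (P, a, l)"
    and v': "v' \<in> tangent_space (orbit_space \<mu>) (P, a, l)"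
    and eq: "\<And>w. w \<in> tangent_space (orbit_space \<mu>) (P, a, l) \<Longrightarrow>
      omega_red (P, a, l) v w = omega_red (P, a, l) v' w"
  shows "v = v'"
proof -
  note T = tangent_space_orbit_space[OF y]
  obtain \<xi> a1 l1 where v: "v = (cross3 P \<xi>, a1, l1)"
    using v unfolding T by blast
  obtain \<xi>' a1' l1' where v': "v' = (cross3 P \<xi>', a1', l1')"
    using v' unfolding T by blast
  have *: "- (P \<bullet> cross3 \<xi> \<eta>) + (l2 * a1 - l1 * a2) =
      - (P \<bullet> cross3 \<xi>' \<eta>) + (l2 * a1' - l1' * a2)" for \<eta> a2 l2
    using eq[of "(cross3 P \<eta>, a2, l2)"] unfolding v v' omega_red_tangent T by blast
  have "cross3 P \<xi> \<bullet> \<eta> = cross3 P \<xi>' \<bullet> \<eta>" for \<eta>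
    using *[of \<eta> 0 0] cross_triple[of P \<xi> \<eta>] cross_triple[of P \<xi>' \<eta>] by (simp add: inner_commute)
  then have "cross3 P \<xi> = cross3 P \<xi>'"
    using vector_eq_rdot by blast
  then show ?thesis
    using *[of 0 0 1] *[of 0 1 0] by (simp add: v v')
qed

lemma symplectic_manifold_orbit_space: "symplectic_manifold (orbit_space \<mu>) omega_red"
  unfolding symplectic_manifold_def
proof (intro conjI ballI impI)
  show "\<exists>d. embedded_submanifold d (orbit_space \<mu>)"
    unfolding orbit_space_def coadjoint_orbit_eq_sphere
    using exists_embedded_submanifold_sphere embedded_submanifold_Times_UNIV by blast
  let ?\<Omega> = "omega_red_extension (- 1 / (\<mu> \<bullet> \<mu>))"
  have smooth: "smooth_on UNIV (\<lambda>y. ?\<Omega> y v w)" for v w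
    unfolding omega_red_extension_def by (intro smooth_on_intros' open_UNIV)
  have alt: "?\<Omega> y v v = 0" for y v
    by (simp add: omega_red_extension_def)
  have restrict: "?\<Omega> y v w = omega_red y v w" if "y \<in> orbit_space \<mu>"
    "v \<in> tangent_space (orbit_space \<mu>) y" "w \<in> tangent_space (orbit_space \<mu>) y" for y v w
    using omega_red_extension_eq that by (metis prod.exhaust)
  have closed: "ext_deriv2 ?\<Omega> y u v w = 0" if "y \<in> orbit_space \<mu>"
    "u \<in> tangent_space (orbit_space \<mu>) y" "v \<in> tangent_space (orbit_space \<mu>) y"
    "w \<in> tangent_space (orbit_space \<mu>) y" for y u v w
  proof -
    note mem = that
    obtain P a l where y: "y = (P, a, l)" by (metis prod.exhaust)
    have "\<exists>\<xi>. fst v = cross3 P \<xi>" if "v \<in> tangent_space (orbit_space \<mu>) y" for v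
      using that unfolding y tangent_space_orbit_space[OF \<open>y \<in> _\<close>[unfolded y]] by auto
    then obtain \<xi> \<eta> \<zeta> where "fst u = cross3 P \<xi>" "fst v = cross3 P \<eta>" "fst w = cross3 P \<zeta>"
      using mem(2-4) by meson
    then show ?thesis
      by (simp add: ext_deriv2_def frechet_derivative_omega_red_extension cross3_triple_tangent)
  qed
  show "closed_two_form (orbit_space \<mu>) omega_red"
    unfolding closed_two_form_def using smooth alt restrict closed bilinear_omega_red_extension
    by (intro ballI exI[of _ UNIV] exI[of _ ?\<Omega>]) auto
  fix y v assume y: "y \<in> orbit_space \<mu>" and v: "v \<in> tangent_space (orbit_space \<mu>) y"
    and eq: "\<forall>w\<in>tangent_space (orbit_space \<mu>) y. omega_red y v w = 0"
  obtain P a l where y_eq: "y = (P, a, l)" by (metis prod.exhaust)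
  note T = tangent_space_orbit_space[OF y[unfolded y_eq]]
  have 0: "0 \<in> tangent_space (orbit_space \<mu>) (P, a, l)"
    unfolding T by (auto simp: zero_prod_def intro!: exI[of _ 0])
  have "omega_red (P, a, l) 0 w = 0" if "w \<in> tangent_space (orbit_space \<mu>) (P, a, l)" for w
    using restrict[OF y, of 0 w] that 0 bilinear_lzero[OF bilinear_omega_red_extension]
    by (simp add: y_eq)
  then show "v = 0"
    using omega_red_inject[OF y[unfolded y_eq] v[unfolded y_eq] 0] eq by (simp add: y_eq)
qed

section \<open>The action of the rotation group and its momentum map\<close>

lemma linear_act_TQ: "linear (act_TQ B)"
  by (auto simp: linear_iff act_TQ_def bilinear_radd[OF bilinear_matrix_mult]
      bilinear_rmul[OF bilinear_matrix_mult])

lemma act_TQ_mem: "B \<in> SO3 \<Longrightarrow> x \<in> TQ \<Longrightarrow> act_TQ B x \<in> TQ"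
  using SO3_mult by (auto simp: act_TQ_def TQ_def)

lemma smooth_left_action_TQ: "smooth_left_action TQ act_TQ"
  unfolding smooth_left_action_def
proof (intro conjI ballI)
  have "smooth_on UNIV (\<lambda>y :: (real^3^3) \<times> phase. (fst y ** fst (snd y), snd (snd y)))"
    by (intro smooth_on_intros' open_UNIV)
  then show "smooth_map (SO3 \<times> TQ) (\<lambda>(B, x). act_TQ B x)"
    by (rule smooth_mapI[OF open_UNIV subset_UNIV]) (auto simp: act_TQ_def)
next
  fix B :: "real^3^3" assume "B \<in> SO3"
  then show "act_TQ B \<in> TQ \<rightarrow> TQ"
    using act_TQ_mem by blast
qed (auto simp: act_TQ_def matrix_mul_assoc)

lemma free_action_TQ: "free_action TQ act_TQ"
  unfolding free_action_def
proof (intro ballI impI)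
  fix B x assume "B \<in> SO3" "x \<in> TQ" "act_TQ B x = x"
  then have "fst x \<in> SO3" "B ** fst x = fst x"
    by (auto simp: act_TQ_def TQ_def case_prod_beta' prod_eq_iff)
  then show "B = mat 1"
    by (metis SO3_mult_transpose(1) matrix_mul_assoc matrix_mul_rid)
qed

text \<open>The map is injective, with continuous inverse given by \<open>B = A' ** transpose A\<close>, and its image
  is cut out of \<open>TQ \<times> TQ\<close> by closed conditions.\<close>

lemma proper_action_TQ: "proper_action TQ act_TQ"
  unfolding proper_action_def
proof (rule closed_injective_imp_proper_map)
  let ?f = "\<lambda>(B, x). (act_TQ B x, x)"
  let ?g = "\<lambda>y :: phase \<times> phase. (fst (fst y) ** transpose (fst (snd y)), snd y)"
  have gf: "?g (?f y) = y" if "y \<in> SO3 \<times> TQ" for y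
    using that SO3_mult_transpose(1)
    by (auto simp: act_TQ_def TQ_def matrix_mul_assoc[symmetric])
  then show "inj_on ?f (topspace (top_of_set (SO3 \<times> TQ)))"
    by (intro inj_on_inverseI[of _ ?g]) auto
  have "smooth_on UNIV ?g"
    by (intro smooth_on_intros' open_UNIV)
  then have cg: "continuous_on UNIV ?g"
    by (rule smooth_on_imp_continuous_on)
  have "smooth_on UNIV (\<lambda>y :: (real^3^3) \<times> phase. ((fst y ** fst (snd y), snd (snd y)), snd y))"
    by (intro smooth_on_intros' open_UNIV)
  moreover have "(\<lambda>y :: (real^3^3) \<times> phase. ((fst y ** fst (snd y), snd (snd y)), snd y)) = ?f"
    by (auto simp: act_TQ_def fun_eq_iff)
  ultimately have "smooth_on UNIV ?f"
    by (simp only:)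
  then have cf: "continuous_on UNIV ?f"
    by (rule smooth_on_imp_continuous_on)
  show "closed_map (top_of_set (SO3 \<times> TQ)) (top_of_set (TQ \<times> TQ)) ?f"
    unfolding closed_map_def
  proof (intro allI impI)
    fix C assume "closedin (top_of_set (SO3 \<times> TQ)) C"
    then obtain K where K: "closed K" "C = (SO3 \<times> TQ) \<inter> K"
      by (metis closedin_closed)
    let ?K = "{y. ?g y \<in> K} \<inter> {y. ?f (?g y) = y}"
    have "closed {y. ?g y \<in> K}"
      using closed_vimage[OF K(1) cg] by (simp only: vimage_def)
    moreover have "closed {y. ?f (?g y) = y}"
      by (intro closed_Collect_eq continuous_on_compose2[OF cf cg] continuous_on_id subset_UNIV)
    ultimately have "closed ?K"
      by (rule closed_Int)
    moreover have "?f ` C = (TQ \<times> TQ) \<inter> ?K"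
    proof (intro equalityI subsetI)
      fix y assume "y \<in> ?f ` C"
      then obtain z where z: "z \<in> C" "y = ?f z" by blast
      then have "?g y = z"
        using gf K by blast
      then show "y \<in> (TQ \<times> TQ) \<inter> ?K"
        using z K act_TQ_mem by auto
    next
      fix y assume y: "y \<in> (TQ \<times> TQ) \<inter> ?K"
      then have "fst (fst y) \<in> SO3" "fst (snd y) \<in> SO3" "snd y \<in> TQ"
        by (auto simp: TQ_def)
      then have "?g y \<in> SO3 \<times> TQ"
        using SO3_mult SO3_transpose by (metis mem_Sigma_iff)
      then have "?g y \<in> C" "y = ?f (?g y)"
        using y K by auto
      then show "y \<in> ?f ` C" by blast
    qed
    ultimately show "closedin (top_of_set (TQ \<times> TQ)) (?f ` C)"
      by (simp only: closedin_closed_Int)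
  qed
qed

text \<open>Matrices enter \<open>omega_Q\<close> only through products
  \<open>transpose A ** C\<close>, which left multiplication by a rotation preserves.\<close>

lemma omega_Q_act:
  assumes "B \<in> SO3"
  shows "omega_Q (act_TQ B x) (act_TQ B v) (act_TQ B w) = omega_Q x v w"
proof -
  have "transpose (B ** A) ** (B ** C) = transpose A ** C" for A C :: "real^3^3"
    by (simp add: matrix_transpose_mul matrix_mul_assoc[symmetric] SO3_cancel[OF assms])
  then show ?thesis
    by (simp add: omega_Q_proj act_TQ_def case_prod_beta')
qed

lemma symplectic_action_TQ: "symplectic_action TQ omega_Q act_TQ"
  unfolding symplectic_action_def
  by (simp add: tangent_map_linear linear_act_TQ omega_Q_act)

lemma hat_tangent_SO3: "hat \<xi> \<in> tangent_space SO3 (mat 1)"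
  using cay_SO3 by (intro tangent_spaceI[OF _ _ has_vector_derivative_cay]) auto

text \<open>Left translation generates \<open>hat \<xi> ** A\<close>. Moving \<open>A\<close> to the
  front turns \<xi> into its body representation, the form in which \<open>omega_Q_tangent\<close>
  applies.\<close>

lemma inf_generator_TQ:
  assumes "A \<in> SO3"
  shows "inf_generator act_TQ \<xi> (A, P, a, l) = (A ** hat (transpose A *v \<xi>), 0, 0, 0)"
proof -
  have "linear (\<lambda>B. B ** A)"
    using bilinear_matrix_mult by (auto simp: bilinear_def)
  from linear_imp_has_derivative_at[OF this]
  have "((\<lambda>B. act_TQ B (A, P, a, l)) has_derivative (\<lambda>B. (B ** A, 0, 0, 0))) (at (mat 1))"
    unfolding act_TQ_def by (auto intro!: derivative_eq_intros simp: zero_prod_def)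
  from tangent_map_eq[OF hat_tangent_SO3 this open_UNIV]
  have "inf_generator act_TQ \<xi> (A, P, a, l) = (hat \<xi> ** A, 0, 0, 0)"
    by (simp add: inf_generator_def)
  then show ?thesis
    by (simp add: SO3_hat_conj[OF assms] SO3_cancel[OF assms])
qed

text \<open>With \<open>z = transpose A *v \<xi>\<close>, the form on the generator and
  \<open>v\<close> is \<open>P' \<bullet> z + P \<bullet> cross3 z \<eta>\<close>. A cyclic shift of
  the triple product makes it \<open>(P' + cross3 \<eta> P) \<bullet> z\<close>, the derivative of
  \<open>A *v P\<close> paired with \<xi>.\<close>

lemma equivariant_momentum_map_TQ: "equivariant_momentum_map TQ omega_Q act_TQ J_Q"
  unfolding equivariant_momentum_map_def
proof (intro conjI ballI allI)
  have "smooth_on UNIV (\<lambda>x :: phase. fst x *v fst (snd x))"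
    by (intro smooth_on_intros' open_UNIV)
  then show "smooth_map TQ J_Q"
    by (rule smooth_mapI[OF open_UNIV subset_UNIV]) (auto simp: J_Q_def)
next
  fix \<xi> :: "real^3" and x v :: phase
  assume x: "x \<in> TQ" and v: "v \<in> tangent_space TQ x"
  obtain A P a l where x_eq: "x = (A, P, a, l)" by (metis prod.exhaust)
  have A: "A \<in> SO3"
    using x by (simp add: x_eq TQ_def)
  obtain \<eta> P' a' l' where v_eq: "v = (A ** hat \<eta>, P', a', l')"
    using v unfolding x_eq tangent_space_TQ[OF A] by blast
  have "((\<lambda>y. J_Q y \<bullet> \<xi>) has_derivative
      (\<lambda>w. (case w of (A', P', a', l') \<Rightarrow> A *v P' + A' *v P) \<bullet> \<xi>)) (at x)"
    unfolding x_eq by (rule has_derivative_inner_left[OF has_derivative_J_Q])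
  from tangent_map_eq[OF v this open_UNIV]
  have "tangent_map TQ (\<lambda>y. J_Q y \<bullet> \<xi>) x v = (A *v (P' + cross3 \<eta> P)) \<bullet> \<xi>"
    by (simp add: v_eq matrix_vector_mul_assoc[symmetric] hat_mult_vector matrix_vector_right_distrib)
  also have "\<dots> = (P' + cross3 \<eta> P) \<bullet> (transpose A *v \<xi>)"
    by (rule SO3_inner_transpose[OF A])
  finally have "tangent_map TQ (\<lambda>y. J_Q y \<bullet> \<xi>) x v = (P' + cross3 \<eta> P) \<bullet> (transpose A *v \<xi>)" .
  then show "omega_Q x (inf_generator act_TQ \<xi> x) v = tangent_map TQ (\<lambda>y. J_Q y \<bullet> \<xi>) x v"
    using cross_triple[of \<eta> P "transpose A *v \<xi>"] cross_triple[of P "transpose A *v \<xi>" \<eta>]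
    by (simp add: x_eq v_eq inf_generator_TQ[OF A] omega_Q_tangent[OF A] inner_add_left inner_add_right inner_commute)
next
  fix B :: "real^3^3" and x :: phase assume "B \<in> SO3"
  then show "J_Q (act_TQ B x) = coAd B (J_Q x)"
    by (simp add: coAd_SO3 J_Q_def act_TQ_def matrix_vector_mul_assoc case_prod_beta')
qed

text \<open>Varying \<open>P\<close> alone already reaches every vector, since \<open>A\<close> is
  invertible.\<close>

lemma regular_value_J_Q: "regular_value TQ J_Q \<mu>"
  unfolding regular_value_def
proof (intro ballI impI)
  fix x :: phase assume x: "x \<in> TQ"
  obtain A P a l where x_eq: "x = (A, P, a, l)" by (metis prod.exhaust)
  have A: "A \<in> SO3"
    using x by (simp add: x_eq TQ_def)
  have "z \<in> tangent_map TQ J_Q x ` tangent_space TQ x" for z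
  proof
    show v: "(A ** hat 0, transpose A *v z, 0, 0) \<in> tangent_space TQ x"
      unfolding x_eq tangent_space_TQ[OF A] by blast
    show "z = tangent_map TQ J_Q x (A ** hat 0, transpose A *v z, 0, 0)"
      using tangent_map_eq[OF v[unfolded x_eq] has_derivative_J_Q open_UNIV]
      by (simp add: x_eq SO3_cancel[OF A] linear_0[OF linear_hat])
  qed
  then show "tangent_map TQ J_Q x ` tangent_space TQ x = UNIV" by blast
qed

subsection \<open>Hamiltonian vector fields and the quotient\<close>

text \<open>Here \<open>g\<close>, \<open>c\<close> and \<open>d\<close> are the partial derivatives
  of \<open>k\<close> in momentum, rotor angle and rotor momentum. Comparing coefficients of
  \<open>P'\<close> gives the velocity \<open>g\<close>, those of \<eta> give
  \<open>cross3 P g\<close>, and the last two coordinates form a canonical pair.\<close>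

lemma ham_vf_TQ:
  assumes k: "(k has_derivative (\<lambda>(P', a', l'). g \<bullet> P' + c * a' + d * l')) (at (P, a, l))"
    and A: "A \<in> SO3"
  shows "ham_vf TQ omega_Q (\<lambda>x. k (proj_red x)) (A, P, a, l) = (A ** hat g, cross3 P g, d, - c)"
proof -
  let ?H = "\<lambda>x. k (proj_red x)" and ?X = "(A ** hat g, cross3 P g, d, - c)"
  note T = tangent_space_TQ[OF A]
  have "proj_red (A, P, a, l) = (P, a, l)"
    by (simp add: proj_red_def)
  then have "(?H has_derivative (\<lambda>w. case proj_red w of (P', a', l') \<Rightarrow> g \<bullet> P' + c * a' + d * l'))
      (at (A, P, a, l))"
    using has_derivative_compose[OF linear_imp_has_derivative_at[OF linear_proj_red]] k by metis
  note dH = tangent_map_eq[OF _ this open_UNIV UNIV_I refl]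
  have eq: "omega_Q (A, P, a, l) ?X w = tangent_map TQ ?H (A, P, a, l) w"
    if w: "w \<in> tangent_space TQ (A, P, a, l)" for w
  proof -
    obtain \<eta> P' a' l' where w_eq: "w = (A ** hat \<eta>, P', a', l')"
      using w unfolding T by blast
    have "P \<bullet> cross3 g \<eta> = cross3 P g \<bullet> \<eta>"
      by (metis cross_triple inner_commute)
    then have "omega_Q (A, P, a, l) ?X w = g \<bullet> P' + c * a' + d * l'"
      by (simp add: w_eq omega_Q_tangent[OF A] inner_commute)
    also have "\<dots> = tangent_map TQ ?H (A, P, a, l) w"
      unfolding dH[OF w] by (simp add: w_eq proj_red_def)
    finally show ?thesis .
  qed
  have X: "?X \<in> tangent_space TQ (A, P, a, l)"
    unfolding T by blast
  show ?thesis
    unfolding ham_vf_def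
  proof (rule the_equality)
    fix v assume v: "v \<in> tangent_space TQ (A, P, a, l) \<and>
      (\<forall>w\<in>tangent_space TQ (A, P, a, l). omega_Q (A, P, a, l) v w = tangent_map TQ ?H (A, P, a, l) w)"
    show "v = ?X"
      by (rule omega_Q_inject[OF A conjunct1[OF v] X]) (use v eq in auto)
  qed (use X eq in blast)
qed

text \<open>Only derivatives along the orbit enter, so any ambient function \<open>k\<close>
  agreeing with \<open>h\<close> on it can be differentiated in place of \<open>h\<close>, whose
  values elsewhere are arbitrary.\<close>

lemma ham_vf_orbit_space:
  assumes k: "(k has_derivative (\<lambda>(P', a', l'). g \<bullet> P' + c * a' + d * l')) (at (P, a, l))"
    and h: "\<And>y. y \<in> orbit_space \<mu> \<Longrightarrow> h y = k y" and y: "(P, a, l) \<in> orbit_space \<mu>"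
  shows "ham_vf (orbit_space \<mu>) omega_red h (P, a, l) = (cross3 P g, d, - c)"
proof -
  let ?T = "tangent_space (orbit_space \<mu>) (P, a, l)" and ?X = "(cross3 P g, d, - c)"
  note T = tangent_space_orbit_space[OF y]
  have dh: "tangent_map (orbit_space \<mu>) h (P, a, l) w =
      (case w of (P', a', l') \<Rightarrow> g \<bullet> P' + c * a' + d * l')" if "w \<in> ?T" for w
    using tangent_map_eq[OF that k open_UNIV] h by simp
  have eq: "omega_red (P, a, l) ?X w = tangent_map (orbit_space \<mu>) h (P, a, l) w" if w: "w \<in> ?T" for w
  proof -
    obtain \<eta> a' l' where w_eq: "w = (cross3 P \<eta>, a', l')"
      using w unfolding T by blast
    have "g \<bullet> cross3 P \<eta> = - (P \<bullet> cross3 g \<eta>)"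
      by (metis cross_skew cross_triple inner_commute inner_minus_right)
    then show ?thesis
      unfolding dh[OF w] by (simp add: w_eq omega_red_tangent)
  qed
  have X: "?X \<in> ?T"
    unfolding T by blast
  show ?thesis
    unfolding ham_vf_def
  proof (rule the_equality)
    fix v assume v: "v \<in> ?T \<and>
      (\<forall>w\<in>?T. omega_red (P, a, l) v w = tangent_map (orbit_space \<mu>) h (P, a, l) w)"
    show "v = ?X"
      by (rule omega_red_inject[OF y conjunct1[OF v] X]) (use v eq in auto)
  qed (use X eq in blast)
qed

section \<open>The orbit space as a quotient of the level set\<close>

lemma descend_eq:
  assumes "\<And>x y. x \<in> L \<Longrightarrow> y \<in> L \<Longrightarrow> \<pi> x = \<pi> y \<Longrightarrow> f x = f y" "x \<in> L"
  shows "descend L \<pi> f (\<pi> x) = f x"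
  unfolding descend_def
  using assms by (metis f_inv_into_f imageI inv_into_into)

text \<open>The only rotation that can carry \<open>A\<close> to \<open>A'\<close> is
  \<open>A' ** transpose A\<close>, and it fixes \<mu> exactly when \<open>P = P'\<close>. The
  second claim is the same equivalence with the rotor momentum dropped.\<close>

lemma proj_red_eq_iff:
  assumes "x \<in> level_set TQ J_Q \<mu>" "y \<in> level_set TQ J_Q \<mu>"
  shows "proj_red x = proj_red y \<longleftrightarrow> (\<exists>B\<in>isotropy \<mu>. y = act_TQ B x)"
    and "base_red (proj_red x) = base_red (proj_red y) \<longleftrightarrow>
      (\<exists>B\<in>isotropy \<mu>. base_TQ y = base_TQ (act_TQ B x))"
proof -
  obtain A P a l where x: "x = (A, P, a, l)" by (metis prod.exhaust)
  obtain A' P' a' l' where y: "y = (A', P', a', l')" by (metis prod.exhaust)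
  have A: "A \<in> SO3" "A *v P = \<mu>" and A': "A' \<in> SO3" "A' *v P' = \<mu>"
    using assms by (simp_all add: x y mem_level_set)
  have isotropy: "B \<in> isotropy \<mu> \<longleftrightarrow> B \<in> SO3 \<and> B *v \<mu> = \<mu>" for B
    using coAd_SO3 by (auto simp: isotropy_def)
  let ?B = "A' ** transpose A"
  have B: "?B \<in> SO3" "?B ** A = A'"
    using SO3_mult[OF A'(1) SO3_transpose[OF A(1)]]
    by (auto simp: matrix_mul_assoc[symmetric] SO3_mult_transpose[OF A(1)])
  have "?B \<in> isotropy \<mu>" if "P = P'"
    using B A A' that SO3_cancel(3)[OF A(1), of P]
    by (auto simp: isotropy matrix_vector_mul_assoc[symmetric])
  moreover have "P = P'" if "B \<in> isotropy \<mu>" "A' = B ** A" for B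
  proof -
    have "A' *v P = A' *v P'"
      using that A A' by (simp add: isotropy matrix_vector_mul_assoc[symmetric])
    then show ?thesis
      by (metis SO3_cancel(3)[OF A'(1)])
  qed
  ultimately have "P = P' \<longleftrightarrow> (\<exists>B\<in>isotropy \<mu>. A' = B ** A)"
    using B by metis
  then show "proj_red x = proj_red y \<longleftrightarrow> (\<exists>B\<in>isotropy \<mu>. y = act_TQ B x)"
    and "base_red (proj_red x) = base_red (proj_red y) \<longleftrightarrow>
      (\<exists>B\<in>isotropy \<mu>. base_TQ y = base_TQ (act_TQ B x))"
    by (auto simp: x y proj_red_def act_TQ_def base_red_def base_TQ_def)
qed

lemma proj_red_act_TQ: "proj_red (act_TQ B x) = proj_red x"
  by (simp add: proj_red_def act_TQ_def case_prod_beta')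

lemma isotropy_subset: "isotropy \<mu> \<subseteq> SO3"
  by (auto simp: isotropy_def)

text \<open>Locally \<open>f'\<close> is \<open>f\<close> composed with a smooth section of
  \<open>proj_red\<close>. The section must take values in the level set, since \<open>f\<close> is
  known to be smooth only along it.\<close>

lemma smooth_map_orbit_space:
  assumes f: "smooth_map (level_set TQ J_Q \<mu>) f"
    and f': "\<And>x. x \<in> level_set TQ J_Q \<mu> \<Longrightarrow> f' (proj_red x) = f x"
  shows "smooth_map (orbit_space \<mu>) f'"
proof (rule smooth_map_locally)
  fix y assume "y \<in> orbit_space \<mu>"
  then have "fst y \<in> sphere 0 (norm \<mu>)"
    by (auto simp: orbit_space_def coadjoint_orbit_eq_sphere)
  then obtain U s where U: "open U" "fst y \<in> U" "smooth_on U s"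
    and s: "\<And>P. P \<in> sphere 0 (norm \<mu>) \<inter> U \<Longrightarrow> s P \<in> SO3 \<and> s P *v P = \<mu>"
    by (rule sphere_local_section) blast
  let ?U = "U \<times> (UNIV :: (real \<times> real) set)" and ?s = "\<lambda>z. (s (fst z), z)"
  have oU: "open ?U"
    using U(1) by (simp add: open_Times)
  have sec: "?s z \<in> level_set TQ J_Q \<mu>" "proj_red (?s z) = z" if "z \<in> orbit_space \<mu> \<inter> ?U" for z
  proof -
    obtain P a l where z: "z = (P, a, l)" by (metis prod.exhaust)
    show "?s z \<in> level_set TQ J_Q \<mu>"
      using that s[of P] by (simp add: z mem_level_set mem_orbit_space)
    show "proj_red (?s z) = z"
      by (simp add: z proj_red_def)
  qed
  have "smooth_on ?U (\<lambda>z. s (fst z))"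
    by (rule smooth_on_compose[OF oU U(1,3)]) (auto intro!: smooth_on_intros oU)
  then have "smooth_on ?U ?s"
    by (intro smooth_on_intros oU)
  then have "smooth_map (orbit_space \<mu> \<inter> ?U) ?s"
    using oU by (intro smooth_mapI[of ?U _ ?s]) auto
  then have "smooth_map (orbit_space \<mu> \<inter> ?U) (\<lambda>z. f (?s z))"
    by (rule smooth_map_compose[OF f]) (use sec in blast)
  then have "smooth_map (orbit_space \<mu> \<inter> ?U) f'"
    by (rule smooth_map_cong) (metis sec f')
  then show "\<exists>U. open U \<and> y \<in> U \<and> smooth_map (orbit_space \<mu> \<inter> U) f'"
    using oU U(2) by (intro exI[of _ ?U]) (auto simp: mem_Times_iff)
qed

lemma tangent_map_proj_red:
  "v \<in> tangent_space L x \<Longrightarrow> tangent_map L proj_red x v = proj_red v"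
  by (rule tangent_map_linear[OF _ linear_proj_red])

lemma tangent_space_proj_red:
  assumes "x \<in> level_set TQ J_Q \<mu>"
  shows "proj_red ` tangent_space (level_set TQ J_Q \<mu>) x = tangent_space (orbit_space \<mu>) (proj_red x)"
proof -
  obtain A P a l where x: "x = (A, P, a, l)" by (metis prod.exhaust)
  have y: "(P, a, l) \<in> orbit_space \<mu>"
    using assms proj_red_level_set by (force simp: x proj_red_def)
  have px: "proj_red x = (P, a, l)"
    by (simp add: x proj_red_def)
  show ?thesis
    unfolding px tangent_space_orbit_space[OF y]
  proof (intro equalityI subsetI)
    fix w assume "w \<in> proj_red ` tangent_space (level_set TQ J_Q \<mu>) x"
    then show "w \<in> {(cross3 P \<xi>, a', l') |\<xi> a' l'. True}"
      unfolding x tangent_space_level_set[OF assms[unfolded x]] by (auto simp: proj_red_def)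
  next
    fix w :: reduced assume "w \<in> {(cross3 P \<xi>, a', l') |\<xi> a' l'. True}"
    then obtain \<xi> a' l' where w: "w = (cross3 P \<xi>, a', l')" by blast
    have "(A ** hat \<xi>, cross3 P \<xi>, a', l') \<in> tangent_space (level_set TQ J_Q \<mu>) x"
      unfolding x tangent_space_level_set[OF assms[unfolded x]] by blast
    then show "w \<in> proj_red ` tangent_space (level_set TQ J_Q \<mu>) x"
      by (rule rev_image_eqI) (simp add: w proj_red_def)
  qed
qed

lemma omega_red_proj_red:
  assumes x: "x \<in> level_set TQ J_Q \<mu>"
    and v: "v \<in> tangent_space (level_set TQ J_Q \<mu>) x" and w: "w \<in> tangent_space (level_set TQ J_Q \<mu>) x"
  shows "omega_red (proj_red x) (proj_red v) (proj_red w) = omega_Q x v w"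
proof -
  obtain A P a l where x_eq: "x = (A, P, a, l)" by (metis prod.exhaust)
  have A: "A \<in> SO3"
    using x by (simp add: x_eq mem_level_set)
  note T = tangent_space_level_set[OF x[unfolded x_eq]]
  obtain \<xi> a1 l1 where v_eq: "v = (A ** hat \<xi>, cross3 P \<xi>, a1, l1)"
    using v unfolding x_eq T by blast
  obtain \<eta> a2 l2 where w_eq: "w = (A ** hat \<eta>, cross3 P \<eta>, a2, l2)"
    using w unfolding x_eq T by blast
  \<comment> \<open>Each momentum term of \<open>omega_Q\<close> contributes
    \<open>- (P \<bullet> cross3 \<xi> \<eta>)\<close> and the third term adds one back. One
    negative copy is left, the minus orbit form.\<close>
  have "cross3 P \<eta> \<bullet> \<xi> = - (P \<bullet> cross3 \<xi> \<eta>)" "cross3 P \<xi> \<bullet> \<eta> = P \<bullet> cross3 \<xi> \<eta>"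
    by (metis cross_skew cross_triple inner_commute inner_minus_right)
      (metis cross_triple inner_commute)
  then show ?thesis
    by (simp add: x_eq v_eq w_eq proj_red_def omega_red_tangent omega_Q_tangent[OF A])
qed

lemma reduced_space_TQ:
  "reduced_space TQ base_TQ omega_Q act_TQ J_Q \<mu> proj_red (orbit_space \<mu>) base_red omega_red"
  unfolding reduced_space_def Let_def
  using symplectic_manifold_orbit_space smooth_map_linear[OF linear_proj_red] proj_red_level_set
    tangent_space_proj_red proj_red_eq_iff
  by (simp add: tangent_map_proj_red omega_red_proj_red cong: image_cong)

section \<open>The spacecraft Hamiltonian and its vector fields\<close>

definition Ham_red :: "real \<Rightarrow> real \<Rightarrow> real \<Rightarrow> real \<Rightarrow> real \<Rightarrow> real \<Rightarrow> reduced \<Rightarrow> real" where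
  "Ham_red I1 I2 I3 J31 J32 J3 y =
     (1/2) * ((fst y $ 1)\<^sup>2 / (I1 + J31) + (fst y $ 2)\<^sup>2 / (I2 + J32)
       + (fst y $ 3 - snd (snd y))\<^sup>2 / I3 + (snd (snd y))\<^sup>2 / J3)"

text \<open>The gradient of \<open>Ham_red\<close> in the body momentum, i.e. the angular velocity
  of the carrier.\<close>

definition angular_velocity :: "real \<Rightarrow> real \<Rightarrow> real \<Rightarrow> real \<Rightarrow> real \<Rightarrow> reduced \<Rightarrow> real^3" where
  "angular_velocity I1 I2 I3 J31 J32 y =
     vector [fst y $ 1 / (I1 + J31), fst y $ 2 / (I2 + J32), (fst y $ 3 - snd (snd y)) / I3]"

text \<open>The partial derivative of \<open>Ham_red\<close> in the rotor momentum, hence the rate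
  of the rotor angle.\<close>

definition rotor_velocity :: "real \<Rightarrow> real \<Rightarrow> reduced \<Rightarrow> real" where
  "rotor_velocity I3 J3 y = snd (snd y) / J3 - (fst y $ 3 - snd (snd y)) / I3"

lemma Ham_eq: "Ham I1 I2 I3 J31 J32 J3 = (\<lambda>x. Ham_red I1 I2 I3 J31 J32 J3 (proj_red x))"
  by (auto simp: Ham_def Ham_red_def proj_red_def)

locale spacecraft_rotor =
  fixes I1 I2 I3 J31 J32 J3 :: real
  assumes inertia: "I1 > 0" "I2 > 0" "I3 > 0" "J31 \<ge> 0" "J32 \<ge> 0" "J3 > 0"
begin

abbreviation "k \<equiv> Ham_red I1 I2 I3 J31 J32 J3"
abbreviation "g \<equiv> angular_velocity I1 I2 I3 J31 J32"
abbreviation "d \<equiv> rotor_velocity I3 J3"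

lemma nonzero: "I1 + J31 \<noteq> 0" "I2 + J32 \<noteq> 0" "I3 \<noteq> 0" "J3 \<noteq> 0"
  using inertia by auto

text \<open>The rotor angle is cyclic. The summand \<open>0 * a'\<close> records this in the shape
  that \<open>ham_vf_TQ\<close> and \<open>ham_vf_orbit_space\<close> expect.\<close>

lemma has_derivative_Ham_red:
  "(k has_derivative (\<lambda>(P', a', l'). g y \<bullet> P' + 0 * a' + d y * l')) (at y)"
proof -
  have [derivative_intros]: "((\<lambda>y :: reduced. fst y $ i) has_derivative (\<lambda>z. fst z $ i)) (at y)" for i
    by (rule linear_imp_has_derivative_at) (auto simp: linear_iff)
  \<comment> \<open>Free coefficients stand for the reciprocal inertias, so the differentiation
    meets no quotients.\<close>
  have "((\<lambda>y :: reduced. (1/2) * (c1 * (fst y $ 1)\<^sup>2 + c2 * (fst y $ 2)\<^sup>2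
        + c3 * (fst y $ 3 - snd (snd y))\<^sup>2 + c4 * (snd (snd y))\<^sup>2)) has_derivative
      (\<lambda>z. c1 * (fst y $ 1) * (fst z $ 1) + c2 * (fst y $ 2) * (fst z $ 2)
        + c3 * (fst y $ 3 - snd (snd y)) * (fst z $ 3)
        + (c4 * snd (snd y) - c3 * (fst y $ 3 - snd (snd y))) * snd (snd z))) (at y)" for c1 c2 c3 c4
    by (auto intro!: derivative_eq_intros simp: fun_eq_iff field_simps)
  from this[of "1 / (I1 + J31)" "1 / (I2 + J32)" "1 / I3" "1 / J3"] show ?thesis
    by (simp add: Ham_red_def[abs_def] angular_velocity_def rotor_velocity_def inner_vec_def sum_3
        case_prod_beta')
qed

lemma smooth_on_Ham_red: "smooth_on UNIV k"
  unfolding Ham_red_def using nonzero by (intro smooth_on_intros open_UNIV)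

lemma ham_vf_Ham:
  assumes "A \<in> SO3"
  shows "ham_vf TQ omega_Q (Ham I1 I2 I3 J31 J32 J3) (A, P, a, l) =
    (A ** hat (g (P, a, l)), cross3 P (g (P, a, l)), d (P, a, l), 0)"
  using ham_vf_TQ[OF has_derivative_Ham_red assms] by (simp add: Ham_eq)

lemma ham_vf_Ham_red:
  assumes "\<And>y. y \<in> orbit_space \<mu> \<Longrightarrow> h y = k y" "y \<in> orbit_space \<mu>"
  shows "ham_vf (orbit_space \<mu>) omega_red h y = (cross3 (fst y) (g y), d y, 0)"
  using ham_vf_orbit_space[OF has_derivative_Ham_red assms(1),
      where P = "fst y" and a = "fst (snd y)" and l = "snd (snd y)"]
    assms(2)
  by simp

lemma smooth_on_reduced_vf: "smooth_on UNIV (\<lambda>y. (cross3 (fst y) (g y), d y, 0 :: real))"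
proof -
  \<comment> \<open>Written as a combination of fixed axis vectors, the velocity falls under the
    closure rules for smooth functions.\<close>
  have "g = (\<lambda>y. (fst y $ 1 / (I1 + J31)) *\<^sub>R axis 1 1 + (fst y $ 2 / (I2 + J32)) *\<^sub>R axis 2 1
      + ((fst y $ 3 - snd (snd y)) / I3) *\<^sub>R axis 3 1)"
    by (auto simp: angular_velocity_def vec_eq_iff forall_3 axis_def)
  moreover have "smooth_on UNIV \<dots>"
    using nonzero by (intro smooth_on_intros open_UNIV)
  ultimately have "smooth_on UNIV g"
    by (simp only:)
  moreover have "smooth_on UNIV d"
    unfolding rotor_velocity_def using nonzero by (intro smooth_on_intros open_UNIV)
  ultimately show ?thesis
    by (intro smooth_on_intros' open_UNIV)
qed

end

text \<open>A tangent space is a set of velocities of curves, so closure under sums is read off from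
  the explicit description, which is linear in the parameters. It is needed to add the lift to the
  Hamiltonian field.\<close>

lemma add_tangent_level_set:
  assumes "x \<in> level_set TQ J_Q \<mu>"
    "v \<in> tangent_space (level_set TQ J_Q \<mu>) x" "w \<in> tangent_space (level_set TQ J_Q \<mu>) x"
  shows "v + w \<in> tangent_space (level_set TQ J_Q \<mu>) x"
proof -
  obtain A P a l where x: "x = (A, P, a, l)" by (metis prod.exhaust)
  note T = tangent_space_level_set[OF assms(1)[unfolded x]]
  obtain \<xi> a1 l1 \<eta> a2 l2 where "v = (A ** hat \<xi>, cross3 P \<xi>, a1, l1)" "w = (A ** hat \<eta>, cross3 P \<eta>, a2, l2)"
    using assms(2,3) unfolding x T by blast
  then have "v + w = (A ** hat (\<xi> + \<eta>), cross3 P (\<xi> + \<eta>), a1 + a2, l1 + l2)"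
    by (simp add: linear_add[OF linear_hat] matrix_add_ldistrib cross_add_right)
  then show ?thesis
    unfolding x T by blast
qed

subsection \<open>The reduced system\<close>

theorem theorem3p1:
  fixes I1 I2 I3 J31 J32 J3 :: real
    and \<mu> :: "real^3"
    and W :: "phase set"
    and u :: "phase \<Rightarrow> phase"
    and vlift :: "(phase \<Rightarrow> phase) \<Rightarrow> (phase \<Rightarrow> phase) \<Rightarrow> phase \<Rightarrow> phase"
  defines "H \<equiv> Ham I1 I2 I3 J31 J32 J3"
    and "L \<equiv> level_set TQ J_Q \<mu>"
    and "V \<equiv> vlift u (ham_vf TQ omega_Q (Ham I1 I2 I3 J31 J32 J3))"
  assumes inertia: "I1 > 0" "I2 > 0" "I3 > 0" "J31 \<ge> 0" "J32 \<ge> 0" "J3 > 0"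
    and W: "fiber_submanifold TQ base_TQ W"
    and u: "control TQ base_TQ W u"
    and u_inv: "\<forall>B\<in>SO3. \<forall>x\<in>TQ. u (act_TQ B x) = act_TQ B (u x)"
    and u_level: "u ` L \<subseteq> W \<inter> L"
    and V_field: "vector_field TQ V"
    and V_vertical: "\<forall>x\<in>TQ. V x \<in> tangent_space {y \<in> TQ. base_TQ y = base_TQ x} x"
    and V_inv: "\<forall>B\<in>SO3. \<forall>x\<in>TQ. V (act_TQ B x) = tangent_map TQ (act_TQ B) x (V x)"
    and V_level: "\<forall>x\<in>L. V x \<in> tangent_space L x"
  shows "regular_point_reducible TQ base_TQ omega_Q act_TQ J_Q H W u \<and>
    (regular_value TQ J_Q \<mu> \<longrightarrow>
      (let N = orbit_space \<mu>;
           h = descend L proj_red H;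
           um = descend L proj_red (proj_red \<circ> u);
           Vm = descend L proj_red (\<lambda>x. tangent_map L proj_red x (V x));
           X = dynamical_vf TQ omega_Q H V;
           Xred = dynamical_vf N omega_red h Vm
       in Rp_reduced_system TQ base_TQ omega_Q act_TQ J_Q H W u \<mu> proj_red
            N base_red omega_red h (proj_red ` (W \<inter> L)) um \<and>
          vector_field N Vm \<and>
          (\<forall>x\<in>L. Vm (proj_red x) = tangent_map L proj_red x (V x)) \<and>
          vector_field N Xred \<and>
          (\<forall>y\<in>N. Xred y = ham_vf N omega_red h y + Vm y) \<and>
          (\<forall>x\<in>L. X x \<in> tangent_space L x \<and>
                 Xred (proj_red x) = tangent_map L proj_red x (X x))))"
proof -
  interpret spacecraft_rotor I1 I2 I3 J31 J32 J3
    using inertia by unfold_locales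
  let ?N = "orbit_space \<mu>"
  define h where "h = descend L proj_red H"
  define um where "um = descend L proj_red (proj_red \<circ> u)"
  define Vm where "Vm = descend L proj_red (\<lambda>x. tangent_map L proj_red x (V x))"
  define X where "X = dynamical_vf TQ omega_Q H V"
  define Xred where "Xred = dynamical_vf ?N omega_red h Vm"
  have LTQ: "L \<subseteq> TQ"
    unfolding L_def by (rule level_set_subset)
  have projL: "proj_red ` L = ?N"
    unfolding L_def by (rule proj_red_level_set)
  \<comment> \<open>Fibers of the projection lie in group orbits, so invariance under rotations
    supplies the constancy on fibers that every use of \<open>descend\<close> requires.\<close>
  have fiber: "\<exists>B\<in>SO3. y = act_TQ B x" if "x \<in> L" "y \<in> L" "proj_red x = proj_red y" for x y
    using proj_red_eq_iff(1)[of x \<mu> y] that isotropy_subset unfolding L_def by blast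

  have H_proj: "H x = k (proj_red x)" for x
    by (simp add: H_def Ham_eq)
  have h: "h (proj_red x) = H x" if "x \<in> L" for x
    unfolding h_def by (rule descend_eq[OF _ that]) (simp add: H_proj)
  then have h_k: "h y = k y" if "y \<in> ?N" for y
    using that projL H_proj by (metis imageE)

  have um: "um (proj_red x) = proj_red (u x)" if "x \<in> L" for x
    unfolding um_def
  proof (subst descend_eq[OF _ that])
    fix x y assume "x \<in> L" "y \<in> L" "proj_red x = proj_red y"
    with fiber obtain B where "B \<in> SO3" "y = act_TQ B x" by blast
    then have "u y = act_TQ B (u x)"
      using u_inv LTQ \<open>x \<in> L\<close> by blast
    then show "(proj_red \<circ> u) x = (proj_red \<circ> u) y"
      by (simp add: proj_red_act_TQ)
  qed simp

  have projT: "proj_red v \<in> tangent_space ?N (proj_red x)"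
    if "x \<in> L" "v \<in> tangent_space L x" for x v
    using tangent_space_proj_red[OF that(1)[unfolded L_def]] that(2) unfolding L_def by blast
  have TV: "tangent_map L proj_red x (V x) = proj_red (V x)" if "x \<in> L" for x
    using V_level that by (simp add: tangent_map_proj_red)
  have Vm: "Vm (proj_red x) = tangent_map L proj_red x (V x)" if "x \<in> L" for x
    unfolding Vm_def
  proof (rule descend_eq[OF _ that])
    fix x y assume xy: "x \<in> L" "y \<in> L" "proj_red x = proj_red y"
    with fiber obtain B where B: "B \<in> SO3" "y = act_TQ B x" by blast
    have "V x \<in> tangent_space TQ x"
      using V_field LTQ xy by (auto simp: vector_field_def)
    moreover have "V y = tangent_map TQ (act_TQ B) x (V x)"
      using V_inv B LTQ xy by blast
    \<comment> \<open>The action is linear, so its tangent map is the action itself, and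
      \<open>proj_red\<close> forgets it.\<close>
    ultimately have "V y = act_TQ B (V x)"
      by (simp add: tangent_map_linear[OF _ linear_act_TQ])
    then show "tangent_map L proj_red x (V x) = tangent_map L proj_red y (V y)"
      using TV[OF xy(1)] TV[OF xy(2)] by (simp add: proj_red_act_TQ)
  qed

  have smooth_H: "smooth_map TQ H"
    unfolding H_proj[abs_def]
    by (rule smooth_map_compose[OF _ smooth_map_linear[OF linear_proj_red], of UNIV])
      (auto intro: smooth_mapI[OF _ _ smooth_on_Ham_red])
  have smooth_h: "smooth_map ?N h"
    by (rule smooth_mapI[OF open_UNIV subset_UNIV smooth_on_Ham_red]) (simp add: h_k)
  have smooth_um: "smooth_map ?N um"
  proof (rule smooth_map_orbit_space)
    show "smooth_map (level_set TQ J_Q \<mu>) (\<lambda>x. proj_red (u x))"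
      using u unfolding control_def
      by (intro smooth_map_linear_compose[OF linear_proj_red] smooth_map_subset[OF _ level_set_subset])
        simp
  qed (use um L_def in auto)
  have smooth_Vm: "smooth_map ?N Vm"
  proof (rule smooth_map_orbit_space)
    show "smooth_map (level_set TQ J_Q \<mu>) (\<lambda>x. proj_red (V x))"
      using V_field unfolding vector_field_def
      by (intro smooth_map_linear_compose[OF linear_proj_red] smooth_map_subset[OF _ level_set_subset])
        simp
  qed (use Vm TV L_def in auto)

  have "control ?N base_red (proj_red ` (W \<inter> L)) um"
    unfolding control_def
  proof (intro conjI ballI)
    show "proj_red ` (W \<inter> L) \<subseteq> ?N"
      using projL by blast
    show "um \<in> ?N \<rightarrow> proj_red ` (W \<inter> L)"
    proof
      fix y assume "y \<in> ?N"
      then obtain x where "x \<in> L" "y = proj_red x"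
        using projL by blast
      then show "um y \<in> proj_red ` (W \<inter> L)"
        using um[of x] u_level by blast
    qed
    show "smooth_map ?N um" by (rule smooth_um)
    fix y assume "y \<in> ?N"
    then obtain x where x: "x \<in> L" "y = proj_red x"
      using projL by blast
    have "u x \<in> L" "base_TQ (u x) = base_TQ x"
      using u u_level LTQ x(1) by (auto simp: control_def)
    \<comment> \<open>The identity rotation serves as the witness that \<open>x\<close> and
      \<open>u x\<close> have the same base point in the quotient.\<close>
    moreover have "base_TQ (act_TQ (mat 1) x) = base_TQ x"
      by (simp add: base_TQ_def act_TQ_def case_prod_beta')
    moreover have "mat 1 \<in> isotropy \<mu>"
      using SO3_one coAd_SO3[OF SO3_one] by (auto simp: isotropy_def)
    ultimately have "base_red (proj_red x) = base_red (proj_red (u x))"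
      using proj_red_eq_iff(2)[of x \<mu> "u x"] x(1) unfolding L_def by metis
    then show "base_red (um y) = base_red y"
      using um x by simp
  qed
  then have Rp: "Rp_reduced_system TQ base_TQ omega_Q act_TQ J_Q H W u \<mu> proj_red
      ?N base_red omega_red h (proj_red ` (W \<inter> L)) um"
    unfolding Rp_reduced_system_def Let_def RCH_system_def L_def[symmetric]
    using regular_value_J_Q reduced_space_TQ symplectic_manifold_orbit_space h um u_level smooth_h
    by blast
  have "regular_point_reducible TQ base_TQ omega_Q act_TQ J_Q H W u"
    unfolding regular_point_reducible_def RCH_system_def
  proof (intro conjI)
    show "\<forall>B\<in>SO3. \<forall>x\<in>TQ. H (act_TQ B x) = H x"
      by (simp add: H_proj proj_red_act_TQ)
    \<comment> \<open>The given \<mu> and its orbit space are the witnesses.\<close>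
    show "\<exists>\<mu> \<pi> (N :: reduced set) (q :: reduced \<Rightarrow> (real^3) \<times> real) \<omega>N h Wm um.
        Rp_reduced_system TQ base_TQ omega_Q act_TQ J_Q H W u \<mu> \<pi> N q \<omega>N h Wm um"
      using Rp by blast
  qed (use symplectic_manifold_TQ smooth_H u W smooth_left_action_TQ free_action_TQ proper_action_TQ
      symplectic_action_TQ equivariant_momentum_map_TQ u_inv in blast)+

  have field_Vm: "vector_field ?N Vm"
    unfolding vector_field_def
  proof (intro conjI ballI smooth_Vm)
    fix y assume "y \<in> ?N"
    then obtain x where x: "x \<in> L" "y = proj_red x"
      using projL by blast
    then show "Vm y \<in> tangent_space ?N y"
      using projT[OF x(1)] V_level Vm[OF x(1)] TV[OF x(1)] by simp
  qed

  have X: "X x \<in> tangent_space L x" "Xred (proj_red x) = proj_red (X x)" if x: "x \<in> L" for x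
  proof -
    obtain A P a l where x_eq: "x = (A, P, a, l)" by (metis prod.exhaust)
    have A: "A \<in> SO3"
      using x by (simp add: x_eq L_def mem_level_set)
    have px: "proj_red x = (P, a, l)"
      by (simp add: x_eq proj_red_def)
    have y: "(P, a, l) \<in> ?N"
      using projL x px by (metis imageI)
    have hx: "ham_vf TQ omega_Q H x = (A ** hat (g (P, a, l)), cross3 P (g (P, a, l)), d (P, a, l), 0)"
      unfolding x_eq H_def by (rule ham_vf_Ham[OF A])
    \<comment> \<open>Conservation of momentum: the first two components have the form
      \<open>A ** hat \<xi>\<close> and \<open>cross3 P \<xi>\<close> with the same \<xi>, the
      angular velocity.\<close>
    also have "\<dots> \<in> tangent_space L x"
      using x unfolding x_eq L_def by (subst tangent_space_level_set) auto
    finally show "X x \<in> tangent_space L x"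
      using add_tangent_level_set[of x \<mu>] V_level x unfolding X_def dynamical_vf_def L_def by blast
    have "ham_vf ?N omega_red h (P, a, l) = proj_red (ham_vf TQ omega_Q H x)"
      using ham_vf_Ham_red[OF h_k y] unfolding hx by (simp add: proj_red_def)
    moreover have "Vm (P, a, l) = proj_red (V x)"
      using Vm[OF x] TV[OF x] px by simp
    ultimately show "Xred (proj_red x) = proj_red (X x)"
      by (simp add: Xred_def X_def dynamical_vf_def px linear_add[OF linear_proj_red])
  qed
  \<comment> \<open>Smoothness is proved for the closed formula, with which the definite description
    \<open>ham_vf\<close> agrees on the orbit space.\<close>
  have "smooth_map ?N (\<lambda>y. ham_vf ?N omega_red h y)"
    by (rule smooth_mapI[OF open_UNIV subset_UNIV smooth_on_reduced_vf])
      (simp add: ham_vf_Ham_red[OF h_k])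
  then have "smooth_map ?N Xred"
    unfolding Xred_def dynamical_vf_def by (rule smooth_map_add[OF _ smooth_Vm])
  moreover have "Xred y \<in> tangent_space ?N y" if y: "y \<in> ?N" for y
  proof -
    obtain x where x: "x \<in> L" "y = proj_red x"
      using projL y by blast
    then show ?thesis
      using projT[OF x(1) X(1)[OF x(1)]] X(2)[OF x(1)] by simp
  qed
  ultimately have field_Xred: "vector_field ?N Xred"
    by (simp add: vector_field_def)

  show ?thesis
    unfolding Let_def h_def[symmetric] um_def[symmetric] Vm_def[symmetric] X_def[symmetric]
      Xred_def[symmetric]
  proof (intro conjI impI ballI)
    fix x assume x: "x \<in> L"
    show "Xred (proj_red x) = tangent_map L proj_red x (X x)"
      using X[OF x] by (simp add: tangent_map_proj_red)
  qed (use Rp field_Vm Vm field_Xred X \<open>regular_point_reducible _ _ _ _ _ _ _ _\<close> in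
      \<open>auto simp: Xred_def dynamical_vf_def\<close>)
qed

end
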